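(* Let $\mathcal{M}$ be an MDP, $B$ a set of absorbing target states, $c$ a non-negative cost function, $\beta\in(0,1)$, and let $\mathcal{M}'$ be the cleaned-up MDP of $\mathcal{M}$. There exists an optimal policy, i.e., a policy $\pi^{\star}\in\Xi(\mathcal{M},B)$ with $J(\pi^{\star})=\inf_{\pi\in\Xi(\mathcal{M},B)}J(\pi)$, if and only if there exists a policy $\widetilde{\pi}\in\Xi(\mathcal{M}',B)$ such that $J(\widetilde{\pi})=\min_{\pi\in\Pi(\mathcal{M}')}J(\pi)$.
   Context: A Markov decision process (MDP) is a tuple $\mathcal{M}=(S,s_1,\mathcal{A},\mathcal{P})$ with $S$ a finite set of states, $s_1\in S$ an initial state, $\mathcal{A}$ a finite set of actions, $\mathcal{A}(s)\subseteq\mathcal{A}$ the (nonempty) set of actions available in $s$, and $\mathcal{P}:S\times\mathcal{A}\times S\to[0,1]$ with $\sum_{s'\in S}\mathcal{P}_{s,a,s'}=1$ for all $s\in S$, $a\in\mathcal{A}(s)$. A state $s$ is absorbing if $\mathcal{P}_{s,a,s}=1$ for all $a\in\mathcal{A}(s)$. A policy is a sequence $\pi=(d_1,d_2,\ldots)$ of maps $d_t:S\times\mathcal{A}\to[0,1]$ with $\sum_{a\in\mathcal{A}(s)}d_t(s,a)=1$ for all $s$ (at step $t$ in state $s$ the agent takes action $a\in\mathcal{A}(s)$ with probability $d_t(s,a)$); $\Pi(\mathcal{M})$ is the set of all policies. $\Pr^{\pi}_{\mathcal{M}}(Reach[B])$ is the probability that the random path $s_1s_2\ldots$ generated under $\pi$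 satisfies $s_t\in B$ for some $t\geq1$. $\Xi(\mathcal{M},B)$ is the set of policies in $\Pi(\mathcal{M})$ attaining $\max_{\pi\in\Pi(\mathcal{M})}\Pr^{\pi}_{\mathcal{M}}(Reach[B])$; $\Xi(\mathcal{M}',B)$ is the analogous set for $\mathcal{M}'$. For a cost $c:S\times\mathcal{A}\to\mathbb{R}_{\geq0}$, $J(\pi)=\mathbb{E}^{\pi}\big[\sum_{t=1}^{\infty}\beta^{t-1}c(s_t,a_t)\big]$. Cleaned-up MDP. Let $x_s$ be the maximum, over all policies, of the probability of reaching $B$ from $s$ (so $x_s=1$ for $s\in B$, $x_s=0$ if $B$ cannot be reached from $s$, and $x_s=\max_{a\in\mathcal{A}(s)}\sum_{s'}\mathcal{P}_{s,a,s'}x_{s'}$ otherwise). Let $\mathcal{A}_{\max}(s)=\{a\in\mathcal{A}(s): x_s=\sum_{s'}\mathcal{P}_{s,a,s'}x_{s'}\}$. The cleaned-up MDP $\mathcal{M}'$ is obtained from $\mathcal{M}$ by replacing the available actions $\mathcal{A}(s)$ by $\mathcal{A}_{\max}(s)$ for each $s$ (this changes nothing at states in $B$ or at states from which $B$ is unreachable). *)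

theory Defs
  imports "HOL-Probability.Probability"
begin

text \<open>
  The transition kernel is a pmf for every pair of a state and an action; well-formedness
  constrains it only at pairs whose action is available, and nothing below uses the other pairs.
\<close>

record ('s, 'a) mdp =
  states :: "'s set"
  init :: 's
  actions :: "'a set"
  avail :: "'s \<Rightarrow> 'a set"
  trans :: "'s \<Rightarrow> 'a \<Rightarrow> 's pmf"

definition is_mdp :: "('s, 'a) mdp \<Rightarrow> bool" where
  "is_mdp M \<longleftrightarrow>
     finite (states M) \<and> init M \<in> states M \<and> finite (actions M) \<and>
     (\<forall>s\<in>states M. avail M s \<noteq> {} \<and> avail M s \<subseteq> actions M \<and>
        (\<forall>a\<in>avail M s. set_pmf (trans M s a) \<subseteq> states M))"

definition absorbing :: "('s, 'a) mdp \<Rightarrow> 's \<Rightarrow> bool" where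
  "absorbing M s \<longleftrightarrow> (\<forall>a\<in>avail M s. pmf (trans M s a) s = 1)"

text \<open>
  Randomized, time-dependent Markov policies. Time is counted from 0: the decision rule
  \<open>d\<^sub>t\<close> for \<open>t \<ge> 1\<close> is \<open>\<pi> (t - 1)\<close>.
\<close>

type_synonym ('s, 'a) policy = "nat \<Rightarrow> 's \<Rightarrow> 'a pmf"

definition policies :: "('s, 'a) mdp \<Rightarrow> ('s, 'a) policy set" where
  "policies M = {\<pi>. \<forall>t. \<forall>s\<in>states M. set_pmf (\<pi> t s) \<subseteq> avail M s}"

text \<open>
  A path is a sequence \<open>\<omega>\<close> of state-action pairs. Given its first \<open>n\<close> entries, entry \<open>n\<close> is drawn
  as follows: the state is \<open>init M\<close> if \<open>n = 0\<close>, and otherwise is distributed according to the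
  transition kernel at the previous pair; the action is then drawn from \<open>\<pi> n\<close> at that state.
  The law of the whole path is obtained from these kernels by the Ionescu-Tulcea theorem.
\<close>

definition next_state :: "('s, 'a) mdp \<Rightarrow> nat \<Rightarrow> (nat \<Rightarrow> 's \<times> 'a) \<Rightarrow> 's pmf" where
  "next_state M n \<omega> =
     (case n of 0 \<Rightarrow> return_pmf (init M) | Suc m \<Rightarrow> trans M (fst (\<omega> m)) (snd (\<omega> m)))"

definition step_pmf ::
  "('s, 'a) mdp \<Rightarrow> ('s, 'a) policy \<Rightarrow> nat \<Rightarrow> (nat \<Rightarrow> 's \<times> 'a) \<Rightarrow> ('s \<times> 'a) pmf" where
  "step_pmf M \<pi> n \<omega> =
     bind_pmf (next_state M n \<omega>) (\<lambda>s. map_pmf (\<lambda>a. (s, a)) (\<pi> n s))"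

lemma measurable_step_pmf:
  "(\<lambda>\<omega>. measure_pmf (step_pmf M \<pi> n \<omega>))
     \<in> measurable (PiM {0..<n} (\<lambda>_. count_space UNIV)) (subprob_algebra (count_space UNIV))"
proof (cases n)
  case 0
  have "(\<lambda>\<omega>. measure_pmf (step_pmf M \<pi> n \<omega>)) = (\<lambda>\<omega>. measure_pmf (step_pmf M \<pi> n undefined))"
    by (simp add: 0 step_pmf_def next_state_def)
  then show ?thesis
    by (simp add: space_subprob_algebra measure_pmf.subprob_space_axioms)
next
  case (Suc m)
  define g where "g p = measure_pmf (bind_pmf (trans M (fst p) (snd p))
    (\<lambda>s. map_pmf (\<lambda>a. (s, a)) (\<pi> n s)))" for p
  have eq: "(\<lambda>\<omega>. measure_pmf (step_pmf M \<pi> n \<omega>)) = (\<lambda>\<omega>. g (\<omega> m))"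
    by (simp add: Suc step_pmf_def next_state_def g_def fun_eq_iff)
  have g: "g \<in> measurable (count_space UNIV) (subprob_algebra (count_space UNIV))"
    by (simp add: g_def space_subprob_algebra measure_pmf.subprob_space_axioms)
  have "(\<lambda>\<omega>. \<omega> m) \<in> measurable (PiM {0..<n} (\<lambda>_. count_space UNIV)) (count_space UNIV)"
    by (rule measurable_component_singleton) (simp add: Suc)
  from measurable_compose[OF this g] show ?thesis by (simp add: eq)
qed

interpretation path: Ionescu_Tulcea
  "\<lambda>n \<omega>. measure_pmf (step_pmf M \<pi> n \<omega>)" "\<lambda>_. count_space UNIV" for M \<pi>
  by unfold_locales (auto intro: measurable_step_pmf measure_pmf.prob_space_axioms)

definition path_measure ::
  "('s, 'a) mdp \<Rightarrow> ('s, 'a) policy \<Rightarrow> (nat \<Rightarrow> 's \<times> 'a) measure" where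
  "path_measure M \<pi> = path.PF.lim M \<pi>"

lemma sets_path_measure [measurable_cong]:
  "sets (path_measure M \<pi>) = sets (PiM UNIV (\<lambda>_. count_space UNIV))"
  by (simp add: path_measure_def)

lemma space_path_measure [simp]: "space (path_measure M \<pi>) = UNIV"
  by (simp add: path_measure_def space_PiM)

lemma prob_space_path_measure: "prob_space (path_measure M \<pi>)"
proof
  have "emeasure (path.CI M \<pi> {}) {\<lambda>_. undefined} = 1"
    using prob_space.emeasure_space_1[OF path.PF.prob_space_P[of "{}" M \<pi>]]
    by (simp add: path.PF.space_P space_PiM)
  moreover have "path.PF.emb UNIV {} {\<lambda>_. undefined} = (UNIV :: (nat \<Rightarrow> 'a \<times> 'b) set)"
    by (auto simp: prod_emb_def restrict_def)
  ultimately show "emeasure (path_measure M \<pi>) (space (path_measure M \<pi>)) = 1"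
    using path.lim[of "{}" "{\<lambda>_. undefined}" M \<pi>]
    by (simp add: path_measure_def[symmetric] space_PiM sets_PiM_empty)
qed

lemma emeasure_C_prefix:
  "emeasure (path.C M \<pi> 0 n (\<lambda>_. undefined)) {restrict h {0..<n}}
     = ennreal (\<Prod>i<n. pmf (step_pmf M \<pi> i h) (h i))"
proof (induction n)
  case 0
  then show ?case by (simp add: space_PiM restrict_def emeasure_return sets_PiM_empty)
next
  case (Suc n)
  let ?M = "\<lambda>_::nat. count_space (UNIV::('a \<times> 'b) set)"
  have sing: "{restrict h {0..<k}} \<in> sets (PiM {0..<k} ?M)" for k
  proof -
    have "{restrict h {0..<k}} = PiE {0..<k} (\<lambda>i. {h i})"
      by (auto simp: PiE_iff extensional_def restrict_def fun_eq_iff)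
    then show ?thesis by (auto intro!: sets_PiM_I_finite)
  qed
  have st: "step_pmf M \<pi> n (restrict h {0..<n}) = step_pmf M \<pi> n h"
    by (cases n) (auto simp: step_pmf_def next_state_def)
  have u: "(\<lambda>_. undefined) \<in> space (PiM {0..<0} ?M)" by (simp add: space_PiM)
  have "emeasure (path.C M \<pi> 0 (Suc n) (\<lambda>_. undefined)) {restrict h {0..<Suc n}}
    = (\<integral>\<^sup>+x. emeasure (path.eP M \<pi> n x) {restrict h {0..<Suc n}} \<partial>path.C M \<pi> 0 n (\<lambda>_. undefined))"
    using path.measurable_eP[of M \<pi> n] sing[of "Suc n"] path.sets_C[OF u, of M \<pi> n]
    by (subst path.C.simps(2), subst emeasure_bind[where N="PiM {0..<Suc n} ?M"])
       (auto simp: path.space_C[OF u] space_PiM cong: measurable_cong_sets)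
  also have "\<dots> = (\<integral>\<^sup>+x. ennreal (pmf (step_pmf M \<pi> n h) (h n)) * indicator {restrict h {0..<n}} x
      \<partial>path.C M \<pi> 0 n (\<lambda>_. undefined))"
  proof (rule nn_integral_cong)
    fix x assume "x \<in> space (path.C M \<pi> 0 n (\<lambda>_. undefined))"
    then have x: "x \<in> space (PiM {0..<n} ?M)" by (simp add: path.space_C[OF u])
    have "(\<lambda>y. x(n := y)) -` {restrict h {0..<Suc n}} = (if x = restrict h {0..<n} then {h n} else {})"
    proof -
      have xe: "x i = undefined" if "i \<ge> n" for i
        using x that by (auto simp: space_PiM PiE_iff extensional_def)
      have upd: "x(n := y) = restrict h {0..<Suc n} \<longleftrightarrow> x = restrict h {0..<n} \<and> y = h n" for y
        using xe by (auto simp: fun_eq_iff restrict_def less_Suc_eq)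
      show ?thesis unfolding vimage_def singleton_iff upd by auto
    qed
    then show "emeasure (path.eP M \<pi> n x) {restrict h {0..<Suc n}} =
      ennreal (pmf (step_pmf M \<pi> n h) (h n)) * indicator {restrict h {0..<n}} x"
      using path.emeasure_eP[OF x sing[of "Suc n"], of M \<pi>]
      by (auto simp: emeasure_pmf_single st)
  qed
  also have "\<dots> = ennreal (pmf (step_pmf M \<pi> n h) (h n)) * emeasure (path.C M \<pi> 0 n (\<lambda>_. undefined)) {restrict h {0..<n}}"
    using sing[of n] path.sets_C[OF u, of M \<pi> n] by (subst nn_integral_cmult_indicator) auto
  also have "\<dots> = ennreal (\<Prod>i<Suc n. pmf (step_pmf M \<pi> i h) (h i))"
    unfolding Suc by (simp add: ennreal_mult' mult.commute prod_nonneg)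
  finally show ?case .
qed

lemma path_measure_prefix:
  "measure (path_measure M \<pi>) {\<omega>. \<forall>i<n. \<omega> i = h i} = (\<Prod>i<n. pmf (step_pmf M \<pi> i h) (h i))"
proof -
  let ?M = "\<lambda>_::nat. count_space (UNIV::('a \<times> 'b) set)"
  let ?X = "PiE {0..<n} (\<lambda>i. {h i})"
  have eq: "?X = {restrict h {0..<n}}"
    by (auto simp: PiE_iff extensional_def restrict_def fun_eq_iff)
  have X: "?X \<in> sets (PiM {0..<n} ?M)" by (auto intro!: sets_PiM_I_finite)
  have emb: "path.PF.emb UNIV {0..<n} ?X = {\<omega>. \<forall>i<n. \<omega> i = h i}"
    by (auto simp: prod_emb_def PiE_iff)
  have "emeasure (path_measure M \<pi>) {\<omega>. \<forall>i<n. \<omega> i = h i} = emeasure (path.CI M \<pi> {0..<n}) ?X"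
    using path.lim[OF _ X, of M \<pi>] by (simp add: emb path_measure_def)
  also have "\<dots> = emeasure (path.C M \<pi> 0 n (\<lambda>_. undefined)) ?X"
    using path.emeasure_CI[OF order_refl X, of M \<pi>] X by simp
  finally show ?thesis
    by (simp add: eq emeasure_C_prefix measure_def prod_nonneg)
qed

lemma reach_event_in_sets: "{\<omega>. \<exists>t. fst (\<omega> t) \<in> B} \<in> sets (path_measure M \<pi>)"
proof -
  have "Measurable.pred (path_measure M \<pi>) (\<lambda>\<omega>. fst (\<omega> t) \<in> B)" for t
    unfolding pred_def
    using measurable_sets[OF measurable_component_singleton[of t UNIV "\<lambda>_. count_space UNIV"],
        of "{p. fst p \<in> B}"]
    by (simp add: sets_path_measure space_PiM vimage_def)
  then have "Measurable.pred (path_measure M \<pi>) (\<lambda>\<omega>. \<exists>t. fst (\<omega> t) \<in> B)"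
    by measurable
  then show ?thesis
    by (simp add: pred_def)
qed

definition reach_prob :: "('s, 'a) mdp \<Rightarrow> 's set \<Rightarrow> ('s, 'a) policy \<Rightarrow> real" where
  "reach_prob M B \<pi> = measure (path_measure M \<pi>) {\<omega>. \<exists>t. fst (\<omega> t) \<in> B}"

definition max_reach_policies :: "('s, 'a) mdp \<Rightarrow> 's set \<Rightarrow> ('s, 'a) policy set" where
  "max_reach_policies M B = {\<pi>. is_arg_max (reach_prob M B) (\<lambda>\<pi>. \<pi> \<in> policies M) \<pi>}"

definition discounted_cost ::
  "('s, 'a) mdp \<Rightarrow> ('s \<Rightarrow> 'a \<Rightarrow> real) \<Rightarrow> real \<Rightarrow> ('s, 'a) policy \<Rightarrow> real" where
  "discounted_cost M c \<beta> \<pi> =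
     (\<integral>\<omega>. (\<Sum>t. \<beta> ^ t * c (fst (\<omega> t)) (snd (\<omega> t))) \<partial>path_measure M \<pi>)"

text \<open>The maximal reachability probability; the supremum is attained for every well-formed MDP.\<close>

definition max_reach :: "('s, 'a) mdp \<Rightarrow> 's set \<Rightarrow> 's \<Rightarrow> real" where
  "max_reach M B s = (SUP \<pi>\<in>policies M. reach_prob (M\<lparr>init := s\<rparr>) B \<pi>)"

definition max_avail :: "('s, 'a) mdp \<Rightarrow> 's set \<Rightarrow> 's \<Rightarrow> 'a set" where
  "max_avail M B s =
     {a \<in> avail M s. max_reach M B s = (\<Sum>s'\<in>states M. pmf (trans M s a) s' * max_reach M B s')}"

definition cleaned_up :: "('s, 'a) mdp \<Rightarrow> 's set \<Rightarrow> ('s, 'a) mdp" where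
  "cleaned_up M B = M\<lparr>avail := max_avail M B\<rparr>"

end

theory Submission
  imports Defs
begin

text \<open>
  Write \<open>x\<close> for the maximal reachability probability. If \<open>\<pi>\<close> is reachability-optimal, then so is its
  continuation at every state it visits with positive probability, and there it chooses only actions
  that preserve the expectation of \<open>x\<close>; redefining \<open>\<pi>\<close> at the pairs of time and state of probability
  zero turns it into a policy of the cleaned-up MDP with the same cost. Conversely, every policy of
  the cleaned-up MDP keeps the expectation of \<open>x\<close> constant, so switching after \<open>N\<close> steps to a
  stationary policy that attains \<open>x\<close> at all states makes it reachability-optimal, and raises the cost
  by at most \<open>O(\<beta>\<^sup>N)\<close>. Hence the infimum of the cost over the reachability-optimal policies equals
  the infimum over all policies of the cleaned-up MDP.

  A stationary policy attaining \<open>x\<close> is found by a vanishing-discount argument: for each discount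
  factor some deterministic stationary policy is optimal at all states, and since there are finitely
  many of them, one is optimal for discount factors arbitrarily close to 1.
\<close>

section \<open>The law of the path\<close>

text \<open>A discrete model of the law of the first \<open>n\<close> entries of a path. Histories
  are total functions, \<open>undefined\<close> from index \<open>n\<close> on, so the law is a pmf
  and its support can be followed entry by entry.\<close>

primrec prefix_pmf :: "('s, 'a) mdp \<Rightarrow> ('s, 'a) policy \<Rightarrow> nat \<Rightarrow> (nat \<Rightarrow> 's \<times> 'a) pmf" where
  "prefix_pmf M \<pi> 0 = return_pmf (\<lambda>_. undefined)"
| "prefix_pmf M \<pi> (Suc n) =
     bind_pmf (prefix_pmf M \<pi> n) (\<lambda>h. map_pmf (\<lambda>p. h(n := p)) (step_pmf M \<pi> n h))"

text \<open>Both sides obey the same recursion in \<open>n\<close>: the Ionescu-Tulcea kernel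
  \<open>eP\<close> appends an entry drawn from \<open>step_pmf\<close>, and \<open>step_pmf\<close>
  at \<open>n\<close> reads at most entry \<open>n - 1\<close>, so cutting the history off at
  \<open>n\<close> does not change it.\<close>

lemma C_eq_distr_prefix_pmf:
  "path.C M \<pi> 0 n (\<lambda>_. undefined) =
     distr (prefix_pmf M \<pi> n) (PiM {0..<n} (\<lambda>_. count_space UNIV)) (\<lambda>h. restrict h {0..<n})"
proof (induction n)
  case 0
  show ?case
    by (intro measure_eqI) (auto simp: emeasure_distr emeasure_return measure_pmf.emeasure_eq_measure
       measure_return restrict_def indicator_def)
next
  case (Suc n)
  let ?M = "\<lambda>_::nat. count_space (UNIV::('a \<times> 'b) set)"
  have u: "(\<lambda>_. undefined) \<in> space (PiM {0..<0} ?M)" by (simp add: space_PiM)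
  have meas: "(\<lambda>h. restrict h {0..<k}) \<in> measurable (measure_pmf p) (PiM {0..<k} ?M)" for k p
    by (auto simp: space_PiM)
  have st: "step_pmf M \<pi> n (restrict h {0..<n}) = step_pmf M \<pi> n h" for h
    by (cases n) (auto simp: step_pmf_def next_state_def)
  have upd: "(restrict h {0..<n})(n := p) = restrict (h(n := p)) {0..<Suc n}" for h :: "nat \<Rightarrow> 'a \<times> 'b" and p
    by (auto simp: fun_eq_iff restrict_def)
  have m2: "(\<lambda>x. emeasure (path.eP M \<pi> n x) X) \<in> borel_measurable (PiM {0..<n} ?M)" if "X \<in> sets (PiM {0..<Suc n} ?M)" for X
    using path.measurable_eP[of M \<pi> n] that by measurable
  show ?case
  proof (rule measure_eqI)
    show "sets (path.C M \<pi> 0 (Suc n) (\<lambda>_. undefined)) =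
      sets (distr (prefix_pmf M \<pi> (Suc n)) (PiM {0..<Suc n} ?M) (\<lambda>h. restrict h {0..<Suc n}))"
      using path.sets_C[OF u, of M \<pi> "Suc n"] by simp
    fix X assume "X \<in> sets (path.C M \<pi> 0 (Suc n) (\<lambda>_. undefined))"
    then have X: "X \<in> sets (PiM {0..<Suc n} ?M)"
      using path.sets_C[OF u, of M \<pi> "Suc n"] by simp
    have "emeasure (path.C M \<pi> 0 (Suc n) (\<lambda>_. undefined)) X
      = (\<integral>\<^sup>+x. emeasure (path.eP M \<pi> n x) X \<partial>path.C M \<pi> 0 n (\<lambda>_. undefined))"
      using path.measurable_eP[of M \<pi> n] X path.sets_C[OF u, of M \<pi> n]
      by (subst path.C.simps(2), subst emeasure_bind[where N="PiM {0..<Suc n} ?M"])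
         (auto simp: path.space_C[OF u] space_PiM cong: measurable_cong_sets)
    also have "\<dots> = (\<integral>\<^sup>+h. emeasure (path.eP M \<pi> n (restrict h {0..<n})) X \<partial>prefix_pmf M \<pi> n)"
      unfolding Suc using m2[OF X] by (intro nn_integral_distr[OF meas]) simp
    also have "\<dots> = (\<integral>\<^sup>+h. emeasure (map_pmf (\<lambda>p. h(n := p)) (step_pmf M \<pi> n h))
         ((\<lambda>h. restrict h {0..<Suc n}) -` X) \<partial>prefix_pmf M \<pi> n)"
    proof (rule nn_integral_cong)
      fix h :: "nat \<Rightarrow> 'a \<times> 'b"
      have "restrict h {0..<n} \<in> space (PiM {0..<n} ?M)" by (simp add: space_PiM)
      from path.emeasure_eP[OF this X, of M \<pi>]
      show "emeasure (path.eP M \<pi> n (restrict h {0..<n})) X = emeasure (map_pmf (\<lambda>p. h(n := p)) (step_pmf M \<pi> n h))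
         ((\<lambda>h. restrict h {0..<Suc n}) -` X)"
        by (simp add: st upd vimage_def del: restrict_apply)
    qed
    also have "\<dots> = emeasure (distr (prefix_pmf M \<pi> (Suc n)) (PiM {0..<Suc n} ?M) (\<lambda>h. restrict h {0..<Suc n})) X"
      using X by (simp add: emeasure_distr[OF meas X] del: emeasure_map_pmf)
    finally show "emeasure (path.C M \<pi> 0 (Suc n) (\<lambda>_. undefined)) X = \<dots>" .
  qed
qed

text \<open>The limit measure projects onto the finite-dimensional laws \<open>CI\<close>, and for
  the index set \<open>{0..<n}\<close> this is the iterated kernel \<open>C\<close> computed
  above.\<close>

lemma distr_path_measure_restrict:
  "distr (path_measure M \<pi>) (PiM {0..<n} (\<lambda>_. count_space UNIV)) (\<lambda>\<omega>. restrict \<omega> {0..<n}) =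
     distr (prefix_pmf M \<pi> n) (PiM {0..<n} (\<lambda>_. count_space UNIV)) (\<lambda>h. restrict h {0..<n})"
proof -
  let ?M = "\<lambda>_::nat. count_space (UNIV::('a \<times> 'b) set)"
  have "distr (path_measure M \<pi>) (PiM {0..<n} ?M) (\<lambda>\<omega>. restrict \<omega> {0..<n}) = path.CI M \<pi> {0..<n}"
    unfolding path_measure_def by (rule path.distr_lim) simp
  also have "\<dots> = path.C M \<pi> 0 n (\<lambda>_. undefined)"
  proof (rule measure_eqI)
    have s: "sets (path.C M \<pi> 0 n (\<lambda>_. undefined)) = sets (PiM {0..<n} ?M)"
      using path.sets_C[of "\<lambda>_. undefined" 0 M \<pi> n] by (simp add: space_PiM)
    then show "sets (path.CI M \<pi> {0..<n}) = sets (path.C M \<pi> 0 n (\<lambda>_. undefined))"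
      by (simp add: path.PF.sets_P)
    fix X assume "X \<in> sets (path.CI M \<pi> {0..<n})"
    then have X: "X \<in> sets (PiM {0..<n} ?M)" by (simp add: path.PF.sets_P)
    show "emeasure (path.CI M \<pi> {0..<n}) X = emeasure (path.C M \<pi> 0 n (\<lambda>_. undefined)) X"
      using path.emeasure_CI[OF order_refl X, of M \<pi>] sets.sets_into_space[OF X]
      by (simp add: prod_emb_id space_PiM)
  qed
  finally show ?thesis by (simp add: C_eq_distr_prefix_pmf)
qed

lemma measurable_restrict_path [measurable]:
  "(\<lambda>\<omega>. restrict \<omega> {0..<n}) \<in> path_measure M \<pi> \<rightarrow>\<^sub>M PiM {0..<n} (\<lambda>_. count_space UNIV)"
  unfolding measurable_cong_sets[OF sets_path_measure refl] by (rule measurable_restrict_subset) simp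

lemma measurable_restrict_pmf:
  "(\<lambda>h. restrict h {0..<n}) \<in> measure_pmf p \<rightarrow>\<^sub>M PiM {0..<n} (\<lambda>_. count_space UNIV)"
  by (auto simp: space_PiM)

text \<open>For a pmf, almost surely means everywhere on the support. Since the first
  \<open>n\<close> entries have the same law on both sides, a check on the possible histories
  becomes an almost sure statement about paths.\<close>

lemma AE_path_measure_prefix:
  assumes Q: "Measurable.pred (PiM {0..<n} (\<lambda>_. count_space UNIV)) Q"
    and supp: "\<And>h. h \<in> set_pmf (prefix_pmf M \<pi> n) \<Longrightarrow> Q (restrict h {0..<n})"
  shows "AE \<omega> in path_measure M \<pi>. Q (restrict \<omega> {0..<n})"
proof -
  let ?N = "PiM {0..<n} (\<lambda>_. count_space (UNIV :: ('a \<times> 'b) set))"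
  have "{x \<in> space ?N. Q x} \<in> sets ?N"
    using Q by (simp add: pred_def)
  note iff = AE_distr_iff[OF _ this]
  have "AE x in distr (prefix_pmf M \<pi> n) ?N (\<lambda>h. restrict h {0..<n}). Q x"
    unfolding iff[OF measurable_restrict_pmf] using supp by (simp add: AE_measure_pmf_iff)
  then show ?thesis
    unfolding distr_path_measure_restrict[symmetric] iff[OF measurable_restrict_path] .
qed

lemma distr_path_measure_coordinate:
  "distr (path_measure M \<pi>) (count_space UNIV) (\<lambda>\<omega>. \<omega> n) =
     measure_pmf (map_pmf (\<lambda>h. h n) (prefix_pmf M \<pi> (Suc n)))"
proof -
  let ?N = "PiM {0..<Suc n} (\<lambda>_. count_space (UNIV :: ('a \<times> 'b) set))"
  have m: "(\<lambda>\<omega>. \<omega> n) \<in> ?N \<rightarrow>\<^sub>M count_space UNIV"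
    by (rule measurable_component_singleton) simp
  have "distr (path_measure M \<pi>) (count_space UNIV) (\<lambda>\<omega>. \<omega> n) =
    distr (distr (path_measure M \<pi>) ?N (\<lambda>\<omega>. restrict \<omega> {0..<Suc n})) (count_space UNIV) (\<lambda>\<omega>. \<omega> n)"
    by (simp add: distr_distr[OF m measurable_restrict_path] comp_def)
  also have "\<dots> = distr (prefix_pmf M \<pi> (Suc n)) (count_space UNIV) (\<lambda>h. h n)"
    unfolding distr_path_measure_restrict
    by (simp add: distr_distr[OF m measurable_restrict_pmf] comp_def)
  finally show ?thesis by (simp add: map_pmf_rep_eq)
qed

text \<open>The marginal law of the state at time \<open>n\<close>. Kernel and start state are
  parameters instead of an MDP, so that the same term serves for every initial state and for the
  cleaned-up MDP, which shares the kernel.\<close>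

primrec state_dist :: "('s \<Rightarrow> 'a \<Rightarrow> 's pmf) \<Rightarrow> ('s, 'a) policy \<Rightarrow> 's \<Rightarrow> nat \<Rightarrow> 's pmf" where
  "state_dist K \<pi> s 0 = return_pmf s"
| "state_dist K \<pi> s (Suc n) = bind_pmf (state_dist K \<pi> s n) (\<lambda>s'. bind_pmf (\<pi> n s') (K s'))"

text \<open>Policies are Markov, so the next entry depends on the history only through the current
  one; hence the marginals satisfy a recursion of their own.\<close>

lemma map_prefix_pmf_coordinate:
  "map_pmf (\<lambda>h. h n) (prefix_pmf M \<pi> (Suc n)) =
     bind_pmf (state_dist (trans M) \<pi> (init M) n) (\<lambda>s. map_pmf (Pair s) (\<pi> n s))"
proof (induction n)
  case 0
  show ?case
    by (simp add: bind_return_pmf step_pmf_def next_state_def map_pmf_comp)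
next
  case (Suc n)
  have "map_pmf (\<lambda>h. h (Suc n)) (prefix_pmf M \<pi> (Suc (Suc n))) =
     bind_pmf (map_pmf (\<lambda>h. h n) (prefix_pmf M \<pi> (Suc n))) (\<lambda>p.
       bind_pmf (trans M (fst p) (snd p)) (\<lambda>s. map_pmf (Pair s) (\<pi> (Suc n) s)))"
    unfolding prefix_pmf.simps(2)[of M \<pi> "Suc n"]
    by (simp add: map_bind_pmf map_pmf_comp bind_map_pmf step_pmf_def next_state_def del: prefix_pmf.simps)
  also have "\<dots> = bind_pmf (state_dist (trans M) \<pi> (init M) (Suc n)) (\<lambda>s. map_pmf (Pair s) (\<pi> (Suc n) s))"
    unfolding Suc by (simp add: bind_assoc_pmf bind_map_pmf)
  finally show ?case .
qed

section \<open>Expectations of bounded functions\<close>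

lemma expectation_bind_pmf:
  fixes f :: "'b \<Rightarrow> real"
  assumes "\<And>x. \<bar>f x\<bar> \<le> C"
  shows "measure_pmf.expectation (bind_pmf p q) f =
    measure_pmf.expectation p (\<lambda>x. measure_pmf.expectation (q x) f)"
  unfolding measure_pmf_bind
  by (rule integral_bind[where K="count_space UNIV" and B=C and B'=1])
     (auto simp: assms measure_pmf.finite_measure_axioms space_subprob_algebra
        measure_pmf.subprob_space_axioms measure_pmf.emeasure_space_1[simplified])

lemma integrable_pmf_bounded:
  fixes f :: "'b \<Rightarrow> real"
  assumes "\<And>x. \<bar>f x\<bar> \<le> C"
  shows "integrable (measure_pmf p) f"
  by (rule measure_pmf.integrable_const_bound[where B=C]) (auto simp: assms)

lemma expectation_pmf_cong:
  fixes f g :: "'b \<Rightarrow> real"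
  assumes "\<And>x. x \<in> set_pmf p \<Longrightarrow> f x = g x"
  shows "measure_pmf.expectation p f = measure_pmf.expectation p g"
  by (rule integral_cong_AE) (auto simp: AE_measure_pmf_iff assms)

lemma expectation_pmf_mono:
  fixes f g :: "'b \<Rightarrow> real"
  assumes "\<And>x. \<bar>f x\<bar> \<le> C" "\<And>x. \<bar>g x\<bar> \<le> C" "\<And>x. x \<in> set_pmf p \<Longrightarrow> f x \<le> g x"
  shows "measure_pmf.expectation p f \<le> measure_pmf.expectation p g"
  by (rule integral_mono_AE)
    (auto simp: AE_measure_pmf_iff assms intro: integrable_pmf_bounded[OF assms(1)] integrable_pmf_bounded[OF assms(2)])

text \<open>The difference \<open>g - f\<close> is nonnegative on the support and has expectation
  zero, so it vanishes almost surely, that is, at every point of the support.\<close>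

lemma expectation_pmf_eq_imp_eq:
  fixes f g :: "'b \<Rightarrow> real"
  assumes "\<And>x. \<bar>f x\<bar> \<le> C" "\<And>x. \<bar>g x\<bar> \<le> C" "\<And>x. x \<in> set_pmf p \<Longrightarrow> f x \<le> g x"
    and "measure_pmf.expectation p f = measure_pmf.expectation p g" and "x \<in> set_pmf p"
  shows "f x = g x"
proof -
  have "integrable (measure_pmf p) (\<lambda>x. g x - f x)"
    by (intro Bochner_Integration.integrable_diff integrable_pmf_bounded[OF assms(1)] integrable_pmf_bounded[OF assms(2)])
  moreover have "measure_pmf.expectation p (\<lambda>x. g x - f x) = 0"
    using assms(4) by (subst Bochner_Integration.integral_diff)
      (auto intro: integrable_pmf_bounded[OF assms(1)] integrable_pmf_bounded[OF assms(2)])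
  ultimately have "AE x in measure_pmf p. g x - f x = 0"
    by (subst (asm) integral_nonneg_eq_0_iff_AE) (auto simp: AE_measure_pmf_iff assms)
  then show ?thesis using assms(5) by (simp add: AE_measure_pmf_iff)
qed

section \<open>Reachability and cost through the marginal laws\<close>

abbreviation shift :: "('s, 'a) policy \<Rightarrow> ('s, 'a) policy" where
  "shift \<pi> \<equiv> (\<lambda>t. \<pi> (Suc t))"

lemma set_state_dist:
  assumes "\<And>s a t. s \<in> S \<Longrightarrow> a \<in> set_pmf (\<pi> t s) \<Longrightarrow> set_pmf (K s a) \<subseteq> S" "s \<in> S"
  shows "set_pmf (state_dist K \<pi> s n) \<subseteq> S"
  using assms by (induction n) (auto, blast)

text \<open>Agreement is demanded only at states that \<open>\<pi>\<close> visits with positive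
  probability, which allows a policy to be altered freely at all other pairs of time and
  state.\<close>

lemma state_dist_cong:
  assumes "\<And>t s'. t < n \<Longrightarrow> s' \<in> set_pmf (state_dist K \<pi> s t) \<Longrightarrow> \<pi> t s' = \<pi>' t s'"
  shows "state_dist K \<pi> s n = state_dist K \<pi>' s n"
  using assms
proof (induction n)
  case (Suc n)
  then have "state_dist K \<pi> s n = state_dist K \<pi>' s n" by simp
  then show ?case using Suc.prems[of n] by (auto intro!: bind_pmf_cong)
qed simp

lemma state_dist_add:
  "state_dist K \<pi> s (n + m) =
     bind_pmf (state_dist K \<pi> s n) (\<lambda>s'. state_dist K (\<lambda>t. \<pi> (n + t)) s' m)"
  by (induction m) (auto simp: bind_return_pmf' bind_assoc_pmf)

definition pair_dist :: "('s, 'a) mdp \<Rightarrow> ('s, 'a) policy \<Rightarrow> nat \<Rightarrow> ('s \<times> 'a) pmf" where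
  "pair_dist M \<pi> n = bind_pmf (state_dist (trans M) \<pi> (init M) n) (\<lambda>s. map_pmf (Pair s) (\<pi> n s))"

lemma map_fst_pair_dist: "map_pmf fst (pair_dist M \<pi> n) = state_dist (trans M) \<pi> (init M) n"
  by (simp add: pair_dist_def map_bind_pmf map_pmf_comp map_pmf_const bind_return_pmf')

lemma measurable_coordinate_path [measurable]:
  "(\<lambda>\<omega>. \<omega> n) \<in> path_measure M \<pi> \<rightarrow>\<^sub>M count_space UNIV"
  unfolding measurable_cong_sets[OF sets_path_measure refl]
  by (rule measurable_component_singleton) simp

lemma distr_coordinate:
  "distr (path_measure M \<pi>) (count_space UNIV) (\<lambda>\<omega>. \<omega> n) = measure_pmf (pair_dist M \<pi> n)"
  by (simp only: distr_path_measure_coordinate map_prefix_pmf_coordinate pair_dist_def)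

lemma AE_coordinate:
  assumes "\<And>p. p \<in> set_pmf (pair_dist M \<pi> n) \<Longrightarrow> Q p"
  shows "AE \<omega> in path_measure M \<pi>. Q (\<omega> n)"
proof -
  have "AE p in distr (path_measure M \<pi>) (count_space UNIV) (\<lambda>\<omega>. \<omega> n). Q p"
    unfolding distr_coordinate by (simp add: AE_measure_pmf_iff assms)
  then show ?thesis by (subst (asm) AE_distr_iff) auto
qed

lemma integral_coordinate:
  fixes f :: "'s \<times> 'a \<Rightarrow> real"
  shows "(\<integral>\<omega>. f (\<omega> n) \<partial>path_measure M \<pi>) = measure_pmf.expectation (pair_dist M \<pi> n) f"
  unfolding distr_coordinate[symmetric] by (rule integral_distr[symmetric]) auto

text \<open>The probability of being in \<open>B\<close> exactly at time \<open>n\<close>. For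
  absorbing targets this equals the probability of having reached \<open>B\<close> by time
  \<open>n\<close>, while it depends only on a marginal law.\<close>

definition hit :: "('s, 'a) mdp \<Rightarrow> 's set \<Rightarrow> ('s, 'a) policy \<Rightarrow> 's \<Rightarrow> nat \<Rightarrow> real" where
  "hit M B \<pi> s n = measure_pmf.prob (state_dist (trans M) \<pi> s n) B"

definition stage_cost ::
  "('s, 'a) mdp \<Rightarrow> ('s \<Rightarrow> 'a \<Rightarrow> real) \<Rightarrow> ('s, 'a) policy \<Rightarrow> nat \<Rightarrow> real" where
  "stage_cost M c \<pi> n = measure_pmf.expectation (pair_dist M \<pi> n) (\<lambda>p. c (fst p) (snd p))"

lemma hit_nonneg: "0 \<le> hit M B \<pi> s n" and hit_le_1: "hit M B \<pi> s n \<le> 1"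
  by (simp_all add: hit_def)

lemma reach_prob_nonneg: "0 \<le> reach_prob M B \<pi>"
  by (simp add: reach_prob_def)

lemma reach_prob_le_1: "reach_prob M B \<pi> \<le> 1"
proof -
  interpret prob_space "path_measure M \<pi>" by (rule prob_space_path_measure)
  show ?thesis by (simp add: reach_prob_def)
qed

lemma mdp_trans_in_states:
  assumes "is_mdp M" "\<pi> \<in> policies M" "s \<in> states M" "a \<in> set_pmf (\<pi> t s)"
  shows "set_pmf (trans M s a) \<subseteq> states M"
  using assms unfolding is_mdp_def policies_def by blast

lemma set_state_dist_mdp:
  assumes "is_mdp M" "\<pi> \<in> policies M" "s \<in> states M"
  shows "set_pmf (state_dist (trans M) \<pi> s n) \<subseteq> states M"
  by (rule set_state_dist[OF mdp_trans_in_states[OF assms(1,2)] assms(3)])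

lemma set_pair_dist:
  assumes "is_mdp M" "\<pi> \<in> policies M"
  shows "set_pmf (pair_dist M \<pi> n) \<subseteq> (SIGMA s:states M. avail M s)"
  using assms set_state_dist_mdp[OF assms, of "init M" n]
  unfolding is_mdp_def policies_def pair_dist_def by fastforce

lemma set_pair_dist_actions:
  assumes "is_mdp M" "\<pi> \<in> policies M" "p \<in> set_pmf (pair_dist M \<pi> n)"
  shows "fst p \<in> states M" "snd p \<in> actions M"
  proof -
  have "p \<in> (SIGMA s:states M. avail M s)" using set_pair_dist[OF assms(1,2), of n] assms(3) by blast
  then show "fst p \<in> states M" "snd p \<in> actions M" using assms(1) unfolding is_mdp_def by (auto, blast)
qed

lemma finite_set_pair_dist:
  assumes "is_mdp M" "\<pi> \<in> policies M"
  shows "finite (set_pmf (pair_dist M \<pi> n))"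
  by (rule finite_subset[of _ "states M \<times> actions M"])
     (use assms(1) set_pair_dist_actions[OF assms, of _ n] in \<open>auto simp: is_mdp_def mem_Times_iff\<close>)

lemma prefix_pmf_step:
  assumes "h \<in> set_pmf (prefix_pmf M \<pi> n)" "Suc i < n"
  shows "fst (h (Suc i)) \<in> set_pmf (trans M (fst (h i)) (snd (h i)))"
  using assms
proof (induction n arbitrary: h)
  case (Suc n)
  then obtain h' p where h: "h' \<in> set_pmf (prefix_pmf M \<pi> n)" "p \<in> set_pmf (step_pmf M \<pi> n h')" "h = h'(n := p)"
    by auto
  show ?case
  proof (cases "Suc i < n")
    case True
    with Suc.IH[OF h(1)] show ?thesis by (simp add: h(3))
  next
    case False
    with Suc.prems have "n = Suc i" by simp
    with h(2) show ?thesis by (auto simp: h(3) step_pmf_def next_state_def)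
  qed
qed simp

lemma prefix_pmf_pair:
  assumes "h \<in> set_pmf (prefix_pmf M \<pi> n)" "i < n"
  shows "h i \<in> set_pmf (pair_dist M \<pi> i)"
  using assms
proof (induction n arbitrary: h)
  case (Suc n)
  then obtain h' p where h: "h' \<in> set_pmf (prefix_pmf M \<pi> n)" "p \<in> set_pmf (step_pmf M \<pi> n h')" "h = h'(n := p)"
    by auto
  show ?case
  proof (cases "i < n")
    case True
    with Suc.IH[OF h(1)] show ?thesis by (simp add: h(3))
  next
    case False
    with Suc.prems have "n = i" by simp
    moreover have "h n \<in> set_pmf (map_pmf (\<lambda>h. h n) (prefix_pmf M \<pi> (Suc n)))"
      using Suc.prems(1) by (auto simp del: prefix_pmf.simps)
    ultimately show ?thesis by (simp only: map_prefix_pmf_coordinate pair_dist_def)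
  qed
qed simp

lemma stage_cost_bounds:
  assumes "is_mdp M" "\<pi> \<in> policies M"
    and "\<And>s a. s \<in> states M \<Longrightarrow> a \<in> actions M \<Longrightarrow> 0 \<le> c s a"
    and "\<And>s a. s \<in> states M \<Longrightarrow> a \<in> actions M \<Longrightarrow> c s a \<le> C"
  shows "0 \<le> stage_cost M c \<pi> n" "stage_cost M c \<pi> n \<le> C"
proof -
  show "0 \<le> stage_cost M c \<pi> n"
    unfolding stage_cost_def
    by (rule integral_nonneg_AE) (auto simp: AE_measure_pmf_iff intro!: assms dest: set_pair_dist_actions[OF assms(1,2)])
  show "stage_cost M c \<pi> n \<le> C"
    unfolding stage_cost_def
    by (rule measure_pmf.integral_le_const)
       (auto simp: AE_measure_pmf_iff integrable_measure_pmf_finite finite_set_pair_dist[OF assms(1,2)] intro!: assms dest: set_pair_dist_actions[OF assms(1,2)])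
qed

text \<open>Expectation and sum are exchanged with the geometric series
  \<open>\<beta> ^ n * C\<close> as a majorant. As a result the cost depends on the policy only
  through the laws \<open>pair_dist\<close>.\<close>

lemma discounted_cost_sums:
  assumes mdp: "is_mdp M" and pol: "\<pi> \<in> policies M" and \<beta>: "0 < \<beta>" "\<beta> < 1"
    and nonneg: "\<And>s a. s \<in> states M \<Longrightarrow> a \<in> actions M \<Longrightarrow> 0 \<le> c s a"
    and bound: "\<And>s a. s \<in> states M \<Longrightarrow> a \<in> actions M \<Longrightarrow> c s a \<le> C"
  shows "(\<lambda>n. \<beta> ^ n * stage_cost M c \<pi> n) sums discounted_cost M c \<beta> \<pi>"
proof -
  let ?P = "path_measure M \<pi>"
  let ?f = "\<lambda>n \<omega>. \<beta> ^ n * c (fst (\<omega> n)) (snd (\<omega> n))"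
  have geo: "summable (\<lambda>n. \<beta> ^ n * C)"
    using \<beta> by (intro summable_mult2 summable_geometric) simp
  have int: "integrable ?P (\<lambda>\<omega>. c (fst (\<omega> n)) (snd (\<omega> n)))" for n
  proof -
    have "integrable (distr ?P (count_space UNIV) (\<lambda>\<omega>. \<omega> n)) (\<lambda>p. c (fst p) (snd p))"
      unfolding distr_coordinate by (rule integrable_measure_pmf_finite[OF finite_set_pair_dist[OF mdp pol]])
    then show ?thesis by (subst (asm) integrable_distr_eq) auto
  qed
  have eq: "(\<integral>\<omega>. ?f n \<omega> \<partial>?P) = \<beta> ^ n * stage_cost M c \<pi> n" for n
    using integral_coordinate[where f="\<lambda>p. c (fst p) (snd p)"] by (simp add: stage_cost_def)
  \<comment> \<open>The bounds hold only almost surely, because \<open>c\<close> is constrained only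
    on \<open>states M\<close> and \<open>actions M\<close>, where the path stays with probability
    one.\<close>
  have AE0: "AE \<omega> in ?P. 0 \<le> c (fst (\<omega> n)) (snd (\<omega> n)) \<and> c (fst (\<omega> n)) (snd (\<omega> n)) \<le> C" for n
    by (rule AE_coordinate[where Q="\<lambda>p. 0 \<le> c (fst p) (snd p) \<and> c (fst p) (snd p) \<le> C"])
       (auto intro!: nonneg bound dest: set_pair_dist_actions[OF mdp pol])
  have AE_sum: "AE \<omega> in ?P. summable (\<lambda>n. norm (?f n \<omega>))"
  proof -
    have "AE \<omega> in ?P. \<forall>n. 0 \<le> c (fst (\<omega> n)) (snd (\<omega> n)) \<and> c (fst (\<omega> n)) (snd (\<omega> n)) \<le> C"
      unfolding AE_all_countable using AE0 by blast
    then show ?thesis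
    proof eventually_elim
      case (elim \<omega>)
      show ?case
        by (rule summable_comparison_test'[OF geo, of 0])
           (use elim \<beta> in \<open>auto simp: abs_mult mult_left_mono\<close>)
    qed
  qed
  have norm_eq: "(\<integral>\<omega>. norm (?f n \<omega>) \<partial>?P) = \<beta> ^ n * stage_cost M c \<pi> n" for n
  proof -
    have "(\<integral>\<omega>. norm (?f n \<omega>) \<partial>?P) = (\<integral>\<omega>. ?f n \<omega> \<partial>?P)"
    proof (rule integral_cong_AE)
      show "AE \<omega> in ?P. norm (?f n \<omega>) = ?f n \<omega>"
        using AE0[of n] by eventually_elim (use \<beta> in \<open>simp add: abs_mult\<close>)
    qed (use int[of n] in auto)
    then show ?thesis by (simp only: eq)
  qed
  have sum2: "summable (\<lambda>n. \<integral>\<omega>. norm (?f n \<omega>) \<partial>?P)"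
    unfolding norm_eq
    by (rule summable_comparison_test'[OF geo, of 0])
       (use \<beta> stage_cost_bounds[OF mdp pol nonneg bound] in \<open>auto simp: abs_mult mult_left_mono\<close>)
  have "discounted_cost M c \<beta> \<pi> = (\<Sum>n. \<integral>\<omega>. ?f n \<omega> \<partial>?P)"
    unfolding discounted_cost_def
    by (rule integral_suminf[OF _ AE_sum sum2]) (use int in simp)
  then have "discounted_cost M c \<beta> \<pi> = (\<Sum>n. \<beta> ^ n * stage_cost M c \<pi> n)"
    by (simp only: eq)
  with sum2[unfolded norm_eq] show ?thesis by (simp only: summable_sums)
qed

section \<open>Absorbing targets: reachability as a limit of marginal probabilities\<close>

locale target_mdp =
  fixes M :: "('s, 'a) mdp" and B :: "'s set"
  assumes mdp: "is_mdp M"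
    and B_states: "B \<subseteq> states M"
    and B_absorbing: "\<And>s. s \<in> B \<Longrightarrow> absorbing M s"
begin

lemma trans_absorbing: "s \<in> B \<Longrightarrow> a \<in> avail M s \<Longrightarrow> set_pmf (trans M s a) = {s}"
  using B_absorbing[of s] measure_pmf.prob_eq_1[of "{s}" "trans M s a"] set_pmf_not_empty[of "trans M s a"]
  unfolding absorbing_def by (auto simp: AE_measure_pmf_iff measure_pmf_single)

text \<open>Only the first \<open>n + 2\<close> entries matter, so it suffices to inspect the
  possible histories; in these the action at time \<open>n\<close> is available and the state at
  time \<open>n + 1\<close> is one of its successors.\<close>

lemma target_absorbing_step:
  assumes "\<pi> \<in> policies M"
  shows "AE \<omega> in path_measure M \<pi>. fst (\<omega> n) \<in> B \<longrightarrow> fst (\<omega> (Suc n)) \<in> B"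
proof -
  let ?Q = "\<lambda>\<omega>. fst (\<omega> n) \<in> B \<longrightarrow> fst (\<omega> (Suc n)) \<in> B"
  let ?N = "PiM {0..<Suc (Suc n)} (\<lambda>_. count_space (UNIV :: ('s \<times> 'a) set))"
  have c: "(\<lambda>\<omega>. \<omega> i) \<in> ?N \<rightarrow>\<^sub>M count_space UNIV" if "i < Suc (Suc n)" for i
    using that by (intro measurable_component_singleton) simp
  have "(\<lambda>\<omega>. fst (\<omega> i) \<in> B) \<in> ?N \<rightarrow>\<^sub>M count_space UNIV" if "i < Suc (Suc n)" for i
    using measurable_compose[OF c[OF that], of "\<lambda>p. fst p \<in> B"] by simp
  from this[of n] this[of "Suc n"] have "Measurable.pred ?N ?Q" by simp
  moreover have "?Q (restrict h {0..<Suc (Suc n)})" if h: "h \<in> set_pmf (prefix_pmf M \<pi> (Suc (Suc n)))" for h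
  proof -
    have "h n \<in> set_pmf (pair_dist M \<pi> n)" by (rule prefix_pmf_pair[OF h]) simp
    then have "snd (h n) \<in> avail M (fst (h n))" using set_pair_dist[OF mdp assms, of n] by auto
    moreover have "fst (h (Suc n)) \<in> set_pmf (trans M (fst (h n)) (snd (h n)))"
      by (rule prefix_pmf_step[OF h]) simp
    ultimately show ?thesis using trans_absorbing[of "fst (h n)" "snd (h n)"] by auto
  qed
  ultimately have "AE \<omega> in path_measure M \<pi>. ?Q (restrict \<omega> {0..<Suc (Suc n)})"
    by (rule AE_path_measure_prefix)
  then show ?thesis by simp
qed

text \<open>The events \<open>A n\<close> of reaching \<open>B\<close> by time \<open>n\<close>
  increase to the reachability event. Absorption makes \<open>A n\<close> almost surely equal to
  being in \<open>B\<close> at time \<open>n\<close>, so its measure is \<open>hit\<close>.\<close>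

lemma hit_LIMSEQ_init:
  assumes "\<pi> \<in> policies M"
  shows "hit M B \<pi> (init M) \<longlonglongrightarrow> reach_prob M B \<pi>"
proof -
  let ?P = "path_measure M \<pi>"
  interpret P: prob_space ?P by (rule prob_space_path_measure)
  have meas [measurable]: "Measurable.pred ?P (\<lambda>\<omega>. fst (\<omega> n) \<in> B)" for n
    using measurable_compose[OF measurable_coordinate_path[of n M \<pi>], of "\<lambda>p. fst p \<in> B"] by simp
  define A where "A n = {\<omega> :: nat \<Rightarrow> 's \<times> 'a. \<exists>t\<le>n. fst (\<omega> t) \<in> B}" for n
  have A: "A n \<in> sets ?P" for n
  proof -
    have "Measurable.pred ?P (\<lambda>\<omega>. \<exists>t\<in>{..n}. fst (\<omega> t) \<in> B)" by measurable
    then show ?thesis by (simp add: A_def pred_def Bex_def)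
  qed
  have "measure ?P (A n) = hit M B \<pi> (init M) n" for n
  proof -
    have "AE \<omega> in ?P. \<forall>n. fst (\<omega> n) \<in> B \<longrightarrow> fst (\<omega> (Suc n)) \<in> B"
      unfolding AE_all_countable using target_absorbing_step[OF assms] by blast
    then have "AE \<omega> in ?P. \<omega> \<in> A n \<longleftrightarrow> fst (\<omega> n) \<in> B"
    proof eventually_elim
      case (elim \<omega>)
      have "fst (\<omega> t) \<in> B \<Longrightarrow> t \<le> n \<Longrightarrow> fst (\<omega> n) \<in> B" for t
        by (induction n rule: nat_induct) (use elim in \<open>auto simp: le_Suc_eq\<close>)
      then show ?case by (auto simp: A_def)
    qed
    then have "measure ?P (A n) = measure ?P {\<omega>. fst (\<omega> n) \<in> B}"
      using A[of n] meas[of n] by (intro P.finite_measure_eq_AE) (auto simp: pred_def)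
    also have "{\<omega>. fst (\<omega> n) \<in> B} = (\<lambda>\<omega>. \<omega> n) -` {p. fst p \<in> B} \<inter> space ?P" by auto
    also have "measure ?P \<dots> = measure (distr ?P (count_space UNIV) (\<lambda>\<omega>. \<omega> n)) {p. fst p \<in> B}"
      by (rule measure_distr[symmetric]) auto
    also have "\<dots> = hit M B \<pi> (init M) n"
      unfolding distr_coordinate hit_def map_fst_pair_dist[symmetric]
      by (simp add: vimage_def)
    finally show ?thesis .
  qed
  moreover have "(\<lambda>n. measure ?P (A n)) \<longlonglongrightarrow> measure ?P (\<Union>n. A n)"
    using A by (intro P.finite_Lim_measure_incseq) (auto simp: incseq_def A_def intro: order_trans)
  moreover have "(\<Union>n. A n) = {\<omega>. \<exists>t. fst (\<omega> t) \<in> B}" by (auto simp: A_def)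
  ultimately show ?thesis by (simp add: reach_prob_def)
qed

end

section \<open>An optimal stationary policy for reachability\<close>

abbreviation stationary :: "('s \<Rightarrow> 'a) \<Rightarrow> ('s, 'a) policy" where
  "stationary d \<equiv> (\<lambda>t s. return_pmf (d s))"

context target_mdp
begin

abbreviation reach :: "('s, 'a) policy \<Rightarrow> 's \<Rightarrow> real" where
  "reach \<pi> s \<equiv> reach_prob (M\<lparr>init := s\<rparr>) B \<pi>"

text \<open>The factor \<open>1 - l\<close> normalises the weights \<open>l ^ n\<close> to total
  mass 1: for \<open>0 < l < 1\<close> this is the probability of being in \<open>B\<close> at an
  independent geometric time.\<close>

definition discounted_reach :: "real \<Rightarrow> ('s, 'a) policy \<Rightarrow> 's \<Rightarrow> real" where
  "discounted_reach l \<pi> s = (1 - l) * (\<Sum>n. l ^ n * hit M B \<pi> s n)"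

lemma finite_states: "finite (states M)" and finite_actions: "finite (actions M)"
  and init_state: "init M \<in> states M"
  using mdp by (auto simp: is_mdp_def)

lemma avail_nonempty: "s \<in> states M \<Longrightarrow> avail M s \<noteq> {}"
  and avail_actions: "s \<in> states M \<Longrightarrow> avail M s \<subseteq> actions M"
  and trans_states: "s \<in> states M \<Longrightarrow> a \<in> avail M s \<Longrightarrow> set_pmf (trans M s a) \<subseteq> states M"
  using mdp by (auto simp: is_mdp_def)

lemma finite_avail: "s \<in> states M \<Longrightarrow> finite (avail M s)"
  using finite_subset[OF avail_actions finite_actions] .

lemma policy_avail: "\<pi> \<in> policies M \<Longrightarrow> s \<in> states M \<Longrightarrow> a \<in> set_pmf (\<pi> t s) \<Longrightarrow> a \<in> avail M s"
  by (auto simp: policies_def)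

lemma policies_shift: "\<pi> \<in> policies M \<Longrightarrow> (\<lambda>t. \<pi> (n + t)) \<in> policies M"
  by (auto simp: policies_def)

lemma stationary_policy: "(\<And>s. s \<in> states M \<Longrightarrow> d s \<in> avail M s) \<Longrightarrow> stationary d \<in> policies M"
  by (auto simp: policies_def)

lemma policies_nonempty: "policies M \<noteq> {}"
proof -
  obtain d where "\<And>s. s \<in> states M \<Longrightarrow> d s \<in> avail M s"
    using that[of "\<lambda>s. SOME a. a \<in> avail M s"] avail_nonempty by (simp add: some_in_eq)
  from stationary_policy[OF this] show ?thesis by auto
qed

lemmas set_state_dist_states = set_state_dist_mdp[OF mdp]

lemma hit_LIMSEQ:
  assumes "\<pi> \<in> policies M" "s \<in> states M"
  shows "hit M B \<pi> s \<longlonglongrightarrow> reach \<pi> s"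
proof -
  \<comment> \<open>A change of the initial state preserves all assumptions, so the limit at the
    initial state holds at every state.\<close>
  interpret s: target_mdp "M\<lparr>init := s\<rparr>" B
    using mdp B_states B_absorbing assms(2) by unfold_locales (auto simp: is_mdp_def absorbing_def)
  have "hit (M\<lparr>init := s\<rparr>) B \<pi> s = hit M B \<pi> s" by (simp add: hit_def fun_eq_iff)
  then show ?thesis
    using s.hit_LIMSEQ_init[of \<pi>] assms(1) by (simp add: policies_def)
qed

lemma hit_abs_le_1: "\<bar>hit M B \<pi> s n\<bar> \<le> 1"
  by (simp add: hit_nonneg hit_le_1)

lemma reach_abs_le_1: "\<bar>reach \<pi> s\<bar> \<le> 1"
  by (simp add: reach_prob_nonneg reach_prob_le_1)

lemma hit_0: "hit M B \<pi> s 0 = indicator B s"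
  by (simp add: hit_def)

lemma hit_add:
  "hit M B \<pi> s (n + m) =
     measure_pmf.expectation (state_dist (trans M) \<pi> s n) (\<lambda>s'. hit M B (\<lambda>t. \<pi> (n + t)) s' m)"
proof -
  have *: "hit M B \<pi> s n = measure_pmf.expectation (state_dist (trans M) \<pi> s n) (indicator B)" for \<pi> s n
    by (simp add: hit_def)
  show ?thesis
    unfolding * state_dist_add by (rule expectation_bind_pmf[where C=1]) (simp add: indicator_def)
qed

text \<open>Conditioning on the state at time \<open>n\<close>: a state in \<open>B\<close> remains
  in \<open>B\<close> with probability one, and any other state contributes 0 at time
  \<open>n\<close>.\<close>

lemma hit_mono:
  assumes "\<pi> \<in> policies M" "s \<in> states M" "n \<le> m"
  shows "hit M B \<pi> s n \<le> hit M B \<pi> s m"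
proof -
  have step: "hit M B \<pi> s n \<le> hit M B \<pi> s (Suc n)" for n
  proof -
    have "hit M B \<pi> s n = measure_pmf.expectation (state_dist (trans M) \<pi> s n) (indicator B)"
      by (simp add: hit_def)
    also have "\<dots> \<le> measure_pmf.expectation (state_dist (trans M) \<pi> s n) (\<lambda>s'. hit M B (\<lambda>t. \<pi> (n + t)) s' 1)"
    proof (rule expectation_pmf_mono[where C=1])
      fix s' assume "s' \<in> set_pmf (state_dist (trans M) \<pi> s n)"
      then have s': "s' \<in> states M" using set_state_dist_states[OF assms(1,2)] by auto
      show "indicator B s' \<le> hit M B (\<lambda>t. \<pi> (n + t)) s' 1"
      proof (cases "s' \<in> B")
        case True
        have "measure_pmf.prob (bind_pmf (\<pi> n s') (trans M s')) B = 1"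
          using trans_absorbing[OF True] policy_avail[OF assms(1) s'] True
          by (subst measure_pmf.prob_eq_1) (auto simp: AE_measure_pmf_iff)
        then show ?thesis by (simp add: hit_def bind_return_pmf indicator_def)
      qed (simp add: hit_nonneg)
    qed (auto simp: indicator_def hit_nonneg hit_le_1)
    also have "\<dots> = hit M B \<pi> s (n + 1)" by (rule hit_add[symmetric])
    finally show ?thesis by simp
  qed
  then show ?thesis using assms(3) by (rule lift_Suc_mono_le)
qed

lemma hit_le_reach:
  assumes "\<pi> \<in> policies M" "s \<in> states M"
  shows "hit M B \<pi> s n \<le> reach \<pi> s"
  by (rule incseq_le[OF _ hit_LIMSEQ[OF assms]]) (auto simp: incseq_def hit_mono[OF assms])

text \<open>The limit of \<open>hit_add\<close> as \<open>m\<close> grows, taken inside the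
  expectation by dominated convergence with bound 1. It replaces conditioning of the path measure on
  the first \<open>n\<close> steps.\<close>

lemma reach_add:
  assumes "\<pi> \<in> policies M" "s \<in> states M"
  shows "reach \<pi> s =
    measure_pmf.expectation (state_dist (trans M) \<pi> s n) (\<lambda>s'. reach (\<lambda>t. \<pi> (n + t)) s')"
proof (rule LIMSEQ_unique)
  show "(\<lambda>m. hit M B \<pi> s (n + m)) \<longlonglongrightarrow> reach \<pi> s"
    using LIMSEQ_ignore_initial_segment[OF hit_LIMSEQ[OF assms], of n] by (simp add: add.commute)
  show "(\<lambda>m. hit M B \<pi> s (n + m)) \<longlonglongrightarrow>
    measure_pmf.expectation (state_dist (trans M) \<pi> s n) (\<lambda>s'. reach (\<lambda>t. \<pi> (n + t)) s')"
    unfolding hit_add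
  proof (rule integral_dominated_convergence[where w="\<lambda>_. 1"])
    show "AE s' in state_dist (trans M) \<pi> s n.
        (\<lambda>m. hit M B (\<lambda>t. \<pi> (n + t)) s' m) \<longlonglongrightarrow> reach (\<lambda>t. \<pi> (n + t)) s'"
      using set_state_dist_states[OF assms] hit_LIMSEQ[OF policies_shift[OF assms(1)]]
      by (auto simp: AE_measure_pmf_iff)
  qed (auto simp: hit_nonneg hit_le_1)
qed

section \<open>Discounted reachability and its optimal stationary policies\<close>

lemma summable_discounted_hit:
  assumes "0 < l" "l < (1::real)"
  shows "summable (\<lambda>n. l ^ n * hit M B \<pi> s n)"
  by (rule summable_comparison_test'[OF summable_geometric[of l], of 0])
     (use assms in \<open>auto simp: abs_mult hit_nonneg hit_le_1 mult_left_le\<close>)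

lemma discounted_reach_nonneg: "0 < l \<Longrightarrow> l < 1 \<Longrightarrow> 0 \<le> discounted_reach l \<pi> s"
  unfolding discounted_reach_def
  by (intro mult_nonneg_nonneg suminf_nonneg summable_discounted_hit) (auto simp: hit_nonneg)

lemma discounted_reach_le:
  assumes "0 < l" "l < 1" "\<And>n. hit M B \<pi> s n \<le> r"
  shows "discounted_reach l \<pi> s \<le> r"
proof -
  have "(\<Sum>n. l ^ n * hit M B \<pi> s n) \<le> (\<Sum>n. l ^ n * r)"
    using assms by (intro suminf_le summable_discounted_hit summable_mult2 summable_geometric)
      (auto intro: mult_left_mono)
  also have "\<dots> = 1 / (1 - l) * r"
    using assms by (subst suminf_mult2[symmetric]) (auto simp: suminf_geometric)
  finally show ?thesis
    using assms by (simp add: discounted_reach_def field_simps)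
qed

lemma discounted_reach_le_1: "0 < l \<Longrightarrow> l < 1 \<Longrightarrow> discounted_reach l \<pi> s \<le> 1"
  by (rule discounted_reach_le) (auto simp: hit_le_1)

text \<open>Drop the terms before \<open>N\<close>. As \<open>hit\<close> is nondecreasing in time,
  the remaining values are at least that at \<open>N\<close>, and their normalised weights sum to
  \<open>l ^ N\<close>.\<close>

lemma discounted_reach_ge:
  assumes l: "0 < l" "l < 1" and "\<pi> \<in> policies M" "s \<in> states M"
  shows "l ^ N * hit M B \<pi> s N \<le> discounted_reach l \<pi> s"
proof -
  let ?g = "\<lambda>n. l ^ n * hit M B \<pi> s n"
  have geo: "(\<Sum>n. l ^ n) = 1 / (1 - l)" "summable (\<lambda>n. l ^ n)" using l by (auto simp: suminf_geometric)
  have "1 / (1 - l) * (l ^ N * hit M B \<pi> s N) = (\<Sum>n. l ^ n * (l ^ N * hit M B \<pi> s N))"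
    using geo by (subst suminf_mult2[symmetric]) auto
  also have "\<dots> \<le> (\<Sum>n. ?g (n + N))"
  proof (rule suminf_le)
    show "l ^ n * (l ^ N * hit M B \<pi> s N) \<le> ?g (n + N)" for n
      using l hit_mono[OF assms(3,4), of N "n + N"]
      by (simp add: power_add mult.assoc mult_left_mono)
    show "summable (\<lambda>n. l ^ n * (l ^ N * hit M B \<pi> s N))"
      by (intro summable_mult2 geo)
    show "summable (\<lambda>n. ?g (n + N))"
      using summable_discounted_hit[OF l] by (rule summable_ignore_initial_segment)
  qed
  also have "\<dots> \<le> (\<Sum>n. ?g n)"
    using suminf_split_initial_segment[OF summable_discounted_hit[OF l, of \<pi> s], of N]
      sum_nonneg[of "{..<N}" ?g] l by (simp add: hit_nonneg)
  finally show ?thesis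
    using l by (simp add: discounted_reach_def field_simps)
qed

text \<open>The Bellman equation of a policy: the term for time 0 is split off, and the rest is
  conditioned on the first transition.\<close>

lemma discounted_reach_step:
  assumes l: "0 < l" "l < 1"
  shows "discounted_reach l \<pi> s = (1 - l) * indicator B s +
    l * measure_pmf.expectation (bind_pmf (\<pi> 0 s) (trans M s)) (discounted_reach l (shift \<pi>))"
proof -
  let ?q = "bind_pmf (\<pi> 0 s) (trans M s)"
  have Suc: "hit M B \<pi> s (Suc n) = measure_pmf.expectation ?q (\<lambda>s'. hit M B (shift \<pi>) s' n)" for n
    using hit_add[of \<pi> s 1 n] by (simp add: bind_return_pmf)
  note sm = summable_discounted_hit[OF l]
  have "(\<Sum>n. l ^ n * hit M B \<pi> s n) = indicator B s + (\<Sum>n. l ^ Suc n * hit M B \<pi> s (Suc n))"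
    using suminf_split_head[OF sm[of \<pi> s]] by (simp add: hit_0)
  also have "(\<Sum>n. l ^ Suc n * hit M B \<pi> s (Suc n)) =
      (\<Sum>n. measure_pmf.expectation ?q (\<lambda>s'. l ^ Suc n * hit M B (shift \<pi>) s' n))"
    unfolding Suc by simp
  also have "\<dots> = measure_pmf.expectation ?q (\<lambda>s'. \<Sum>n. l ^ Suc n * hit M B (shift \<pi>) s' n)"
  proof (rule integral_suminf[symmetric])
    show "integrable ?q (\<lambda>s'. l ^ Suc n * hit M B (shift \<pi>) s' n)" for n
      by (intro integrable_mult_right integrable_pmf_bounded[OF hit_abs_le_1])
    have n: "norm (l ^ Suc n * hit M B (shift \<pi>) s' n) = l * (l ^ n * hit M B (shift \<pi>) s' n)" for s' n
      using l by (simp add: abs_mult hit_nonneg)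
    show "AE s' in ?q. summable (\<lambda>n. norm (l ^ Suc n * hit M B (shift \<pi>) s' n))"
      unfolding n by (intro AE_I2 summable_mult sm)
    have "(\<lambda>n. measure_pmf.expectation ?q (\<lambda>s'. norm (l ^ Suc n * hit M B (shift \<pi>) s' n))) =
      (\<lambda>n. l ^ Suc n * hit M B \<pi> s (Suc n))"
      unfolding n Suc by (simp add: mult.assoc)
    then show "summable (\<lambda>n. measure_pmf.expectation ?q (\<lambda>s'. norm (l ^ Suc n * hit M B (shift \<pi>) s' n)))"
      using sm[of \<pi> s] by (simp only: summable_Suc_iff[of "\<lambda>n. l ^ n * hit M B \<pi> s n"])
  qed
  also have "\<dots> = measure_pmf.expectation ?q (\<lambda>s'. l * (\<Sum>n. l ^ n * hit M B (shift \<pi>) s' n))"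
    using sm by (simp add: suminf_mult mult.assoc)
  finally have eq: "(\<Sum>n. l ^ n * hit M B \<pi> s n) = indicator B s +
      l * measure_pmf.expectation ?q (\<lambda>s'. \<Sum>n. l ^ n * hit M B (shift \<pi>) s' n)" by simp
  have eq': "measure_pmf.expectation ?q (discounted_reach l (shift \<pi>)) =
      (1 - l) * measure_pmf.expectation ?q (\<lambda>s'. \<Sum>n. l ^ n * hit M B (shift \<pi>) s' n)"
    unfolding discounted_reach_def[abs_def] by simp
  show ?thesis
    unfolding discounted_reach_def[of l \<pi> s] eq eq' by (simp only: algebra_simps mult_1)
qed

lemma discounted_reach_abs_le_1: "0 < l \<Longrightarrow> l < 1 \<Longrightarrow> \<bar>discounted_reach l \<pi> s\<bar> \<le> 1"
  by (simp add: discounted_reach_nonneg discounted_reach_le_1)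

text \<open>The value function \<open>w\<close> satisfies a Bellman inequality, and \<open>d\<close>
  chooses a maximising action for \<open>w\<close> at every state. The largest gap \<open>m\<close>
  between \<open>w\<close> and the value of \<open>d\<close> then satisfies
  \<open>m \<le> l * m\<close>, so it is not positive.\<close>

lemma discounted_optimal_stationary:
  assumes l: "0 < l" "l < 1"
  shows "\<exists>d\<in>Pi\<^sub>E (states M) (avail M). \<forall>s\<in>states M. \<forall>\<pi>\<in>policies M.
    discounted_reach l \<pi> s \<le> discounted_reach l (stationary d) s"
proof -
  let ?v = "discounted_reach l"
  define w where "w s = (SUP \<pi>\<in>policies M. ?v \<pi> s)" for s
  let ?E = "\<lambda>s a. measure_pmf.expectation (trans M s a) w"
  have bdd: "bdd_above ((\<lambda>\<pi>. ?v \<pi> s) ` policies M)" for s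
    using discounted_reach_le_1[OF l] by (auto intro!: bdd_aboveI)
  have v_le_w: "?v \<pi> s \<le> w s" if "\<pi> \<in> policies M" for \<pi> s
    unfolding w_def by (rule cSUP_upper[OF that bdd])
  have w_le: "w s \<le> 1" for s
    unfolding w_def by (rule cSUP_least[OF policies_nonempty]) (rule discounted_reach_le_1[OF l])
  have w_ge: "0 \<le> w s" for s
    using policies_nonempty v_le_w discounted_reach_nonneg[OF l] by (meson equals0I order_trans)
  have w_abs: "\<bar>w s\<bar> \<le> 1" for s using w_le w_ge by simp
  have "\<exists>a\<in>avail M s. \<forall>b\<in>avail M s. ?E s b \<le> ?E s a" if "s \<in> states M" for s
  proof -
    have "Max (?E s ` avail M s) \<in> ?E s ` avail M s"
      using that finite_avail avail_nonempty by (intro Max_in) auto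
    then obtain a where "a \<in> avail M s" "?E s a = Max (?E s ` avail M s)" by auto
    then show ?thesis using finite_avail[OF that] by (auto intro!: bexI[of _ a])
  qed
  then obtain d0 where d0: "\<And>s. s \<in> states M \<Longrightarrow> d0 s \<in> avail M s"
    "\<And>s b. s \<in> states M \<Longrightarrow> b \<in> avail M s \<Longrightarrow> ?E s b \<le> ?E s (d0 s)" by metis
  \<comment> \<open>Restriction to \<open>states M\<close> puts \<open>d\<close> into a finite
    function space, on which the pigeonhole argument over discount factors relies.\<close>
  define d where "d = restrict d0 (states M)"
  have d: "d \<in> Pi\<^sub>E (states M) (avail M)" using d0(1) by (auto simp: d_def)
  have d_pol: "stationary d \<in> policies M" using d by (intro stationary_policy) auto
  have w_step: "w s \<le> (1 - l) * indicator B s + l * ?E s (d s)" if s: "s \<in> states M" for s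
    unfolding w_def[of s]
  proof (rule cSUP_least[OF policies_nonempty])
    fix \<pi> assume pol: "\<pi> \<in> policies M"
    have "shift \<pi> \<in> policies M" using policies_shift[OF pol, of 1] by simp
    then have "measure_pmf.expectation (bind_pmf (\<pi> 0 s) (trans M s)) (?v (shift \<pi>)) \<le>
      measure_pmf.expectation (bind_pmf (\<pi> 0 s) (trans M s)) w"
      by (intro expectation_pmf_mono[where C=1] discounted_reach_abs_le_1 l w_abs v_le_w)
    also have "\<dots> = measure_pmf.expectation (\<pi> 0 s) (?E s)"
      by (rule expectation_bind_pmf[OF w_abs])
    also have "\<dots> \<le> ?E s (d s)"
    proof (rule measure_pmf.integral_le_const)
      show "AE a in \<pi> 0 s. ?E s a \<le> ?E s (d s)"
        using policy_avail[OF pol s] d0(2)[OF s] s by (auto simp: AE_measure_pmf_iff d_def)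
      show "integrable (\<pi> 0 s) (?E s)"
        using finite_subset[OF _ finite_avail[OF s]] policy_avail[OF pol s]
        by (intro integrable_measure_pmf_finite) blast
    qed
    finally show "?v \<pi> s \<le> (1 - l) * indicator B s + l * ?E s (d s)"
      using l by (subst discounted_reach_step[OF l]) simp
  qed
  let ?D = "\<lambda>s. w s - ?v (stationary d) s"
  define m where "m = Max (?D ` states M)"
  have D_le: "?D s \<le> m" if "s \<in> states M" for s
    unfolding m_def using that finite_states by auto
  have D_step: "?D s \<le> l * m" if s: "s \<in> states M" for s
  proof -
    have int: "integrable (trans M s (d s)) w" "integrable (trans M s (d s)) (?v (stationary d))"
      by (auto intro: integrable_pmf_bounded[OF w_abs] integrable_pmf_bounded[OF discounted_reach_abs_le_1[OF l]])
    have "?D s \<le> l * (?E s (d s) - measure_pmf.expectation (trans M s (d s)) (?v (stationary d)))"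
      using w_step[OF s] discounted_reach_step[OF l, of "stationary d" s]
      by (simp add: bind_return_pmf algebra_simps)
    also have "\<dots> = l * measure_pmf.expectation (trans M s (d s)) ?D"
      using int by simp
    also have "\<dots> \<le> l * m"
    proof (intro mult_left_mono measure_pmf.integral_le_const)
      show "AE s' in trans M s (d s). ?D s' \<le> m"
        using trans_states[OF s] d s D_le by (force simp: AE_measure_pmf_iff)
    qed (use int l in auto)
    finally show ?thesis .
  qed
  \<comment> \<open>The maximum is attained at some state, so the bound of each gap by
    \<open>l * m\<close> applies to \<open>m\<close> itself.\<close>
  have "m \<in> ?D ` states M"
    unfolding m_def using finite_states init_state by (intro Max_in) auto
  with D_step have "m \<le> l * m" by auto
  then have "(1 - l) * m \<le> 0" by (simp add: algebra_simps)
  with l have "m \<le> 0" by (simp add: mult_le_0_iff)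
  then have "?v \<pi> s \<le> ?v (stationary d) s" if "s \<in> states M" "\<pi> \<in> policies M" for s \<pi>
    using D_le[OF that(1)] v_le_w[OF that(2), of s] by simp
  with d show ?thesis by blast
qed

text \<open>Some \<open>d\<close> is optimal for infinitely many of the discount factors
  \<open>l k\<close>. Its discounted values never exceed its reachability probability, while those
  of a competitor are at least \<open>l k ^ N\<close> times its \<open>hit\<close> value at
  \<open>N\<close>.\<close>

lemma optimal_stationary:
  "\<exists>d. (\<forall>s\<in>states M. d s \<in> avail M s) \<and>
     (\<forall>s\<in>states M. \<forall>\<pi>\<in>policies M. reach \<pi> s \<le> reach (stationary d) s)"
proof -
  \<comment> \<open>The summand 2 makes \<open>l 0\<close> equal to 1/2, so that all factors lie
    strictly between 0 and 1.\<close>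
  define l :: "nat \<Rightarrow> real" where "l k = 1 - 1 / (real k + 2)" for k
  have l: "0 < l k" "l k < 1" for k by (auto simp: l_def field_simps)
  have l_lim: "l \<longlonglongrightarrow> 1" unfolding l_def by real_asymp
  let ?R = "\<lambda>k d. \<forall>s\<in>states M. \<forall>\<pi>\<in>policies M.
    discounted_reach (l k) \<pi> s \<le> discounted_reach (l k) (stationary d) s"
  have "\<exists>d\<in>Pi\<^sub>E (states M) (avail M). infinite {k \<in> UNIV. ?R k d}"
    by (rule pigeonhole_infinite_rel)
       (auto intro!: finite_PiE discounted_optimal_stationary finite_states finite_avail l)
  then obtain d where d: "d \<in> Pi\<^sub>E (states M) (avail M)" and inf: "infinite {k. ?R k d}" by auto
  have d_avail: "d s \<in> avail M s" if "s \<in> states M" for s using d that by auto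
  note d_pol = stationary_policy[OF d_avail]
  have "reach \<pi> s \<le> reach (stationary d) s" if s: "s \<in> states M" and pol: "\<pi> \<in> policies M" for s \<pi>
  proof (rule LIMSEQ_le_const2[OF hit_LIMSEQ[OF pol s]], intro exI allI impI)
    fix N
    show "hit M B \<pi> s N \<le> reach (stationary d) s"
    \<comment> \<open>A strict excess of \<open>hit\<close> at time \<open>N\<close> would survive
      the factor \<open>l k ^ N\<close> for all large \<open>k\<close>, leaving only finitely many
      \<open>k\<close> for which \<open>d\<close> is optimal.\<close>
    proof (rule ccontr)
      assume "\<not> ?thesis"
      then have "reach (stationary d) s < 1 ^ N * hit M B \<pi> s N" by simp
      moreover have "(\<lambda>k. l k ^ N * hit M B \<pi> s N) \<longlonglongrightarrow> 1 ^ N * hit M B \<pi> s N"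
        by (intro tendsto_intros l_lim)
      ultimately have ev: "\<forall>\<^sub>F k in sequentially. reach (stationary d) s < l k ^ N * hit M B \<pi> s N"
        by (simp only: order_tendstoD)
      have imp: "l k ^ N * hit M B \<pi> s N \<le> reach (stationary d) s" if "?R k d" for k
      proof -
        have "l k ^ N * hit M B \<pi> s N \<le> discounted_reach (l k) \<pi> s"
          by (rule discounted_reach_ge[OF l pol s])
        also have "\<dots> \<le> discounted_reach (l k) (stationary d) s" using that s pol by blast
        also have "\<dots> \<le> reach (stationary d) s"
          by (rule discounted_reach_le[OF l hit_le_reach[OF d_pol s]])
        finally show ?thesis .
      qed
      have "\<forall>\<^sub>F k in sequentially. \<not> ?R k d"
        using ev by (rule eventually_mono) (use imp not_le in blast)
      then have "finite {k. ?R k d}"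
        unfolding cofinite_eq_sequentially[symmetric] eventually_cofinite by simp
      with inf show False by simp
    qed
  qed
  with d_avail show ?thesis by blast
qed

end

section \<open>Policies of the cleaned-up MDP\<close>

context target_mdp
begin

lemma reach_le_max_reach: "\<pi> \<in> policies M \<Longrightarrow> reach \<pi> s \<le> max_reach M B s"
  unfolding max_reach_def
  by (rule cSUP_upper) (auto intro!: bdd_aboveI[of _ 1] simp: reach_prob_le_1)

lemma max_reach_abs_le_1: "\<bar>max_reach M B s\<bar> \<le> 1"
proof -
  have "max_reach M B s \<le> 1"
    unfolding max_reach_def by (rule cSUP_least[OF policies_nonempty]) (rule reach_prob_le_1)
  moreover have "0 \<le> max_reach M B s"
    using policies_nonempty reach_le_max_reach reach_prob_nonneg by (meson equals0I order_trans)
  ultimately show ?thesis by simp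
qed

text \<open>One choice function that is optimal from all states at once, so that a policy can switch
  to it at any time and in whatever state it is.\<close>

definition optimal_choice :: "'s \<Rightarrow> 'a" where
  "optimal_choice = (SOME d. (\<forall>s\<in>states M. d s \<in> avail M s) \<and>
     (\<forall>s\<in>states M. \<forall>\<pi>\<in>policies M. reach \<pi> s \<le> reach (stationary d) s))"

lemma optimal_choice_avail: "s \<in> states M \<Longrightarrow> optimal_choice s \<in> avail M s"
  using someI_ex[OF optimal_stationary] unfolding optimal_choice_def by blast

lemmas optimal_choice_policy = stationary_policy[OF optimal_choice_avail]

lemma reach_optimal_choice:
  assumes "s \<in> states M"
  shows "reach (stationary optimal_choice) s = max_reach M B s"
proof (rule antisym)
  show "max_reach M B s \<le> reach (stationary optimal_choice) s"
    unfolding max_reach_def using assms someI_ex[OF optimal_stationary]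
    by (intro cSUP_least[OF policies_nonempty]) (simp add: optimal_choice_def)
qed (rule reach_le_max_reach[OF optimal_choice_policy])

lemma max_avail_iff:
  assumes "s \<in> states M" "a \<in> avail M s"
  shows "a \<in> max_avail M B s \<longleftrightarrow> measure_pmf.expectation (trans M s a) (max_reach M B) = max_reach M B s"
proof -
  have "measure_pmf.expectation (trans M s a) (max_reach M B) =
      (\<Sum>s'\<in>states M. max_reach M B s' * pmf (trans M s a) s')"
    using trans_states[OF assms] finite_states by (intro integral_measure_pmf_real) auto
  then show ?thesis using assms by (auto simp: max_avail_def mult.commute)
qed

lemma expectation_max_reach_le:
  assumes "s \<in> states M" "a \<in> avail M s"
  shows "measure_pmf.expectation (trans M s a) (max_reach M B) \<le> max_reach M B s"
proof -
  \<comment> \<open>Plays \<open>a\<close> in \<open>s\<close> at time 0 and the optimal choice from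
    then on; its value at \<open>s\<close> is therefore exactly the expectation of
    \<open>max_reach\<close> after \<open>a\<close>.\<close>
  define \<pi> where "\<pi> t s' = return_pmf (if t = (0::nat) \<and> s' = s then a else optimal_choice s')" for t s'
  have pol: "\<pi> \<in> policies M"
    using assms(2) optimal_choice_avail by (auto simp: policies_def \<pi>_def)
  have "measure_pmf.expectation (trans M s a) (max_reach M B) =
      measure_pmf.expectation (trans M s a) (reach (stationary optimal_choice))"
    using trans_states[OF assms] by (intro expectation_pmf_cong) (auto simp: reach_optimal_choice)
  also have "\<dots> = reach \<pi> s"
  proof -
    have "shift \<pi> = stationary optimal_choice" by (simp add: \<pi>_def fun_eq_iff)
    then show ?thesis
      using reach_add[OF pol assms(1), of 1] by (simp add: bind_return_pmf) (simp add: \<pi>_def bind_return_pmf)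
  qed
  also have "\<dots> \<le> max_reach M B s" by (rule reach_le_max_reach[OF pol])
  finally show ?thesis .
qed

text \<open>The value at \<open>s\<close> averages \<open>?r a\<close> over the chosen actions, and
  \<open>?r a \<le> ?x a \<le> max_reach M B s\<close>. Optimality of the average forces equality
  for each chosen action, and then, inside \<open>?r a = ?x a\<close>, at each successor.\<close>

lemma optimal_policy_step:
  assumes pol: "\<pi> \<in> policies M" and s: "s \<in> states M" and opt: "reach \<pi> s = max_reach M B s"
    and a: "a \<in> set_pmf (\<pi> 0 s)"
  shows "a \<in> max_avail M B s"
    and "s' \<in> set_pmf (trans M s a) \<Longrightarrow> reach (shift \<pi>) s' = max_reach M B s'"
proof -
  let ?r = "\<lambda>a. measure_pmf.expectation (trans M s a) (reach (shift \<pi>))"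
  let ?x = "\<lambda>a. measure_pmf.expectation (trans M s a) (max_reach M B)"
  have "shift \<pi> \<in> policies M" using policies_shift[OF pol, of 1] by simp
  note le = reach_le_max_reach[OF this]
  have r_x: "?r a \<le> ?x a" for a
    by (rule expectation_pmf_mono[where C=1]) (rule reach_abs_le_1 max_reach_abs_le_1 le)+
  have x_max: "?x a \<le> max_reach M B s" if "a \<in> set_pmf (\<pi> 0 s)" for a
    by (rule expectation_max_reach_le[OF s policy_avail[OF pol s that]])
  have r_bound: "\<bar>?r a\<bar> \<le> 1" for a
  proof -
    have "?r a \<le> 1"
      by (rule measure_pmf.integral_le_const)
         (auto simp: reach_prob_le_1 intro: integrable_pmf_bounded[OF reach_abs_le_1])
    moreover have "0 \<le> ?r a" by (simp add: reach_prob_nonneg)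
    ultimately show ?thesis by simp
  qed
  have "measure_pmf.expectation (\<pi> 0 s) ?r = reach \<pi> s"
    using reach_add[OF pol s, of 1]
    by (simp add: bind_return_pmf expectation_bind_pmf[OF reach_abs_le_1])
  with opt have "?r a = max_reach M B s"
    using r_x x_max
    by (intro expectation_pmf_eq_imp_eq[where C=1 and f="?r" and g="\<lambda>_. max_reach M B s"
          and p="\<pi> 0 s", OF r_bound max_reach_abs_le_1 _ _ a])
       (auto intro: order_trans)
  with r_x[of a] x_max[OF a] have eq: "?x a = max_reach M B s" "?r a = ?x a" by auto
  then show "a \<in> max_avail M B s" using max_avail_iff[OF s policy_avail[OF pol s a]] by simp
  show "reach (shift \<pi>) s' = max_reach M B s'" if "s' \<in> set_pmf (trans M s a)"
    by (rule expectation_pmf_eq_imp_eq[where C=1, OF reach_abs_le_1 max_reach_abs_le_1 le eq(2) that])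
qed

lemma optimal_policy_propagates:
  assumes pol: "\<pi> \<in> policies M" and s: "s \<in> states M" and opt: "reach \<pi> s = max_reach M B s"
    and "s' \<in> set_pmf (state_dist (trans M) \<pi> s n)"
  shows "reach (\<lambda>t. \<pi> (n + t)) s' = max_reach M B s'"
  using assms(4)
proof (induction n arbitrary: s')
  case 0
  then show ?case using opt by simp
next
  case (Suc n)
  then obtain s'' a where *: "s'' \<in> set_pmf (state_dist (trans M) \<pi> s n)" "a \<in> set_pmf (\<pi> n s'')"
    "s' \<in> set_pmf (trans M s'' a)" by auto
  moreover have "s'' \<in> states M" using set_state_dist_states[OF pol s] *(1) by auto
  ultimately show ?case
    using optimal_policy_step(2)[OF policies_shift[OF pol, of n] _ Suc.IH[OF *(1)], of a s'] by simp
qed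

lemma optimal_policy_max_avail:
  assumes pol: "\<pi> \<in> policies M" and s: "s \<in> states M" and opt: "reach \<pi> s = max_reach M B s"
    and s': "s' \<in> set_pmf (state_dist (trans M) \<pi> s n)"
  shows "set_pmf (\<pi> n s') \<subseteq> max_avail M B s'"
  using optimal_policy_step(1)[OF policies_shift[OF pol, of n] _ optimal_policy_propagates[OF assms]]
    set_state_dist_states[OF pol s] s' by auto

text \<open>The stationary policy is optimal from \<open>s\<close> itself, so already its decision
  at time 0 must be a maximising action.\<close>

lemma optimal_choice_max_avail:
  assumes "s \<in> states M"
  shows "optimal_choice s \<in> max_avail M B s"
  using optimal_policy_max_avail[OF optimal_choice_policy assms reach_optimal_choice[OF assms], of s 0]
  by simp

section \<open>The cleaned-up MDP: path laws and reachability-optimal policies\<close>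

abbreviation M' :: "('s, 'a) mdp" where "M' \<equiv> cleaned_up M B"

lemma cleaned_up_simps [simp]:
  "states M' = states M" "init M' = init M" "actions M' = actions M"
  "avail M' = max_avail M B" "trans M' = trans M"
  by (simp_all add: cleaned_up_def)

lemma policies_cleaned_up: "policies M' \<subseteq> policies M"
  by (auto simp: policies_def max_avail_def)

text \<open>The law of the path involves the MDP only through its initial state and kernel, which
  cleaning up leaves unchanged.\<close>

lemma path_measure_cleaned_up: "path_measure M' = path_measure M"
proof -
  have "step_pmf M' = step_pmf M"
    by (simp add: step_pmf_def next_state_def fun_eq_iff split: nat.split)
  then show ?thesis by (simp add: path_measure_def fun_eq_iff)
qed

lemma discounted_cost_cleaned_up: "discounted_cost M' c \<beta> = discounted_cost M c \<beta>"
  by (simp add: discounted_cost_def fun_eq_iff path_measure_cleaned_up)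

lemma reach_prob_cleaned_up: "reach_prob M' B = reach_prob M B"
  by (simp add: reach_prob_def fun_eq_iff path_measure_cleaned_up)

text \<open>\<open>optimal_choice\<close> attains the supremum, so being surpassed by no policy
  amounts to attaining \<open>max_reach\<close>.\<close>

lemma max_reach_policies_iff:
  "\<pi> \<in> max_reach_policies M B \<longleftrightarrow> \<pi> \<in> policies M \<and> reach \<pi> (init M) = max_reach M B (init M)"
  using reach_le_max_reach[of _ "init M"] reach_optimal_choice[OF init_state] optimal_choice_policy
  unfolding max_reach_policies_def is_arg_max_def by (auto simp: not_less intro: antisym) (metis antisym)

text \<open>The stationary policy of \<open>optimal_choice\<close> survives the cleaning, so both
  MDPs have the same maximal reachability probability from the initial state.\<close>

lemma max_reach_policies_cleaned_up:
  "max_reach_policies M' B = max_reach_policies M B \<inter> policies M'"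
proof -
  have "stationary optimal_choice \<in> policies M'"
    using optimal_choice_max_avail by (auto simp: policies_def)
  moreover have "stationary optimal_choice \<in> max_reach_policies M B"
    using reach_optimal_choice[OF init_state] optimal_choice_policy by (simp add: max_reach_policies_iff)
  ultimately show ?thesis
    using policies_cleaned_up reach_prob_cleaned_up
    unfolding max_reach_policies_def is_arg_max_def by (auto, (meson le_less_trans less_le_trans not_less subsetD)+)
qed

end

section \<open>Discounted cost under the reachability constraint\<close>

locale discounted_target_mdp = target_mdp M B
  for M :: "('s, 'a) mdp" and B :: "'s set" +
  fixes c :: "'s \<Rightarrow> 'a \<Rightarrow> real" and \<beta> :: real
  assumes cost_nonneg: "\<And>s a. s \<in> states M \<Longrightarrow> a \<in> actions M \<Longrightarrow> 0 \<le> c s a"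
    and \<beta>_pos: "0 < \<beta>" and \<beta>_less_1: "\<beta> < 1"
begin

abbreviation J :: "('s, 'a) policy \<Rightarrow> real" where "J \<equiv> discounted_cost M c \<beta>"

definition cost_bound :: real where
  "cost_bound = Max ((\<lambda>(s, a). c s a) ` (states M \<times> actions M))"

lemma cost_le_bound: "s \<in> states M \<Longrightarrow> a \<in> actions M \<Longrightarrow> c s a \<le> cost_bound"
  unfolding cost_bound_def using finite_states finite_actions by (intro Max_ge) auto

lemma J_sums: "\<pi> \<in> policies M \<Longrightarrow> (\<lambda>n. \<beta> ^ n * stage_cost M c \<pi> n) sums J \<pi>"
  by (rule discounted_cost_sums[OF mdp _ \<beta>_pos \<beta>_less_1 cost_nonneg cost_le_bound])

lemmas stage_cost_nonneg = stage_cost_bounds(1)[OF mdp _ cost_nonneg cost_le_bound]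
lemmas stage_cost_le = stage_cost_bounds(2)[OF mdp _ cost_nonneg cost_le_bound]

lemma J_nonneg: "\<pi> \<in> policies M \<Longrightarrow> 0 \<le> J \<pi>"
  using sums_le[OF _ sums_zero J_sums[of \<pi>]] stage_cost_nonneg[of \<pi>] \<beta>_pos by simp

lemma bdd_below_J: "bdd_below (J ` max_reach_policies M B)"
  using J_nonneg by (auto simp: max_reach_policies_iff intro!: bdd_belowI)

lemma J_cong:
  assumes "\<pi> \<in> policies M" "\<pi>' \<in> policies M" "\<And>n. pair_dist M \<pi> n = pair_dist M \<pi>' n"
  shows "J \<pi> = J \<pi>'"
  using J_sums[OF assms(1)] J_sums[OF assms(2)] sums_unique2
  by (simp add: stage_cost_def assms(3))

lemma optimal_policy_clean:
  assumes "\<pi> \<in> max_reach_policies M B"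
  obtains \<pi>' where "\<pi>' \<in> max_reach_policies M' B" "J \<pi>' = J \<pi>"
proof -
  from assms have pol: "\<pi> \<in> policies M" and opt: "reach \<pi> (init M) = max_reach M B (init M)"
    by (simp_all add: max_reach_policies_iff)
  \<comment> \<open>Membership in \<open>policies M'\<close> restricts the decisions at every time
    and state, visited or not. Optimality settles the visited pairs; the default
    \<open>optimal_choice s\<close> repairs the others.\<close>
  define \<pi>' where "\<pi>' t s = (if set_pmf (\<pi> t s) \<subseteq> max_avail M B s then \<pi> t s
    else return_pmf (optimal_choice s))" for t s
  have pol': "\<pi>' \<in> policies M'"
    using optimal_choice_max_avail by (auto simp: policies_def \<pi>'_def)
  then have pol_M: "\<pi>' \<in> policies M" using policies_cleaned_up by blast
  have same: "\<pi> n s = \<pi>' n s" if "s \<in> set_pmf (state_dist (trans M) \<pi> (init M) n)" for n s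
    using optimal_policy_max_avail[OF pol init_state opt that] by (simp add: \<pi>'_def)
  have dist: "state_dist (trans M) \<pi> (init M) n = state_dist (trans M) \<pi>' (init M) n" for n
    by (rule state_dist_cong) (rule same)
  have "pair_dist M \<pi>' n = pair_dist M \<pi> n" for n
    unfolding pair_dist_def dist[symmetric] by (rule bind_pmf_cong) (auto simp: same)
  then have "J \<pi>' = J \<pi>" by (rule J_cong[OF pol_M pol])
  moreover have "hit M B \<pi> (init M) = hit M B \<pi>' (init M)"
    by (simp add: hit_def fun_eq_iff dist)
  then have "reach \<pi>' (init M) = reach \<pi> (init M)"
    using hit_LIMSEQ[OF pol init_state] hit_LIMSEQ[OF pol_M init_state] LIMSEQ_unique by metis
  then have "\<pi>' \<in> max_reach_policies M' B"
    using pol_M pol' opt by (simp add: max_reach_policies_cleaned_up max_reach_policies_iff)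
  ultimately show ?thesis using that by blast
qed

text \<open>Maximising actions preserve the expectation of \<open>max_reach\<close>, so its value at
  the current state is a martingale.\<close>

lemma expectation_max_reach_cleaned_up:
  assumes "\<pi> \<in> policies M'" "s \<in> states M"
  shows "measure_pmf.expectation (state_dist (trans M) \<pi> s n) (max_reach M B) = max_reach M B s"
proof (induction n)
  case (Suc n)
  have pol: "\<pi> \<in> policies M" using assms(1) policies_cleaned_up by blast
  have "measure_pmf.expectation (state_dist (trans M) \<pi> s (Suc n)) (max_reach M B) =
    measure_pmf.expectation (state_dist (trans M) \<pi> s n) (\<lambda>s'.
      measure_pmf.expectation (bind_pmf (\<pi> n s') (trans M s')) (max_reach M B))"
    by (simp add: expectation_bind_pmf[OF max_reach_abs_le_1])
  also have "\<dots> = measure_pmf.expectation (state_dist (trans M) \<pi> s n) (max_reach M B)"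
  proof (rule expectation_pmf_cong)
    fix s' assume "s' \<in> set_pmf (state_dist (trans M) \<pi> s n)"
    then have s': "s' \<in> states M" using set_state_dist_states[OF pol assms(2)] by auto
    have "measure_pmf.expectation (bind_pmf (\<pi> n s') (trans M s')) (max_reach M B) =
      measure_pmf.expectation (\<pi> n s') (\<lambda>a. measure_pmf.expectation (trans M s' a) (max_reach M B))"
      by (rule expectation_bind_pmf[OF max_reach_abs_le_1])
    also have "\<dots> = measure_pmf.expectation (\<pi> n s') (\<lambda>_. max_reach M B s')"
    proof (rule expectation_pmf_cong)
      fix a assume "a \<in> set_pmf (\<pi> n s')"
      then have "a \<in> max_avail M B s'" using assms(1) s' by (auto simp: policies_def)
      then show "measure_pmf.expectation (trans M s' a) (max_reach M B) = max_reach M B s'"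
        using max_avail_iff[OF s', of a] by (auto simp: max_avail_def)
    qed
    finally show "measure_pmf.expectation (bind_pmf (\<pi> n s') (trans M s')) (max_reach M B) = max_reach M B s'"
      by simp
  qed
  finally show ?case using Suc by simp
qed simp

text \<open>A policy of \<open>M'\<close> may preserve \<open>max_reach\<close> and yet postpone
  reaching \<open>B\<close> forever. The switch at time \<open>N\<close> realises the preserved
  value, since \<open>optimal_choice\<close> attains \<open>max_reach\<close> from each state. Costs
  agree before \<open>N\<close>, and the later ones form a geometric tail.\<close>

lemma switch_to_optimal_choice:
  assumes "\<pi> \<in> policies M'"
  obtains \<pi>' where "\<pi>' \<in> max_reach_policies M' B" "J \<pi>' \<le> J \<pi> + \<beta> ^ N * cost_bound / (1 - \<beta>)"
proof -
  define \<pi>' where "\<pi>' t = (if t < N then \<pi> t else stationary optimal_choice t)" for t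
  have pol: "\<pi> \<in> policies M" using assms policies_cleaned_up by blast
  have pol': "\<pi>' \<in> policies M'"
    using assms optimal_choice_max_avail by (auto simp: policies_def \<pi>'_def)
  then have pol_M: "\<pi>' \<in> policies M" using policies_cleaned_up by blast
  have dist: "state_dist (trans M) \<pi>' (init M) n = state_dist (trans M) \<pi> (init M) n" if "n \<le> N" for n
    by (rule state_dist_cong) (use that in \<open>simp add: \<pi>'_def\<close>)
  have "reach \<pi>' (init M) = measure_pmf.expectation (state_dist (trans M) \<pi>' (init M) N)
      (reach (stationary optimal_choice))"
    using reach_add[OF pol_M init_state, of N] by (simp add: \<pi>'_def)
  also have "\<dots> = measure_pmf.expectation (state_dist (trans M) \<pi>' (init M) N) (max_reach M B)"
    using set_state_dist_states[OF pol_M init_state]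
    by (intro expectation_pmf_cong reach_optimal_choice) blast
  also have "\<dots> = max_reach M B (init M)"
    by (rule expectation_max_reach_cleaned_up[OF pol' init_state])
  finally have "\<pi>' \<in> max_reach_policies M' B"
    using pol_M pol' by (simp add: max_reach_policies_cleaned_up max_reach_policies_iff)
  moreover have "J \<pi>' \<le> J \<pi> + \<beta> ^ N * cost_bound / (1 - \<beta>)"
  proof (rule sums_le[OF _ J_sums[OF pol_M] sums_add[OF J_sums[OF pol]]])
    \<comment> \<open>Excess cost per stage: none before the switch; afterwards the new stage cost
      is at most \<open>cost_bound\<close> and the old one at least 0.\<close>
    let ?e = "\<lambda>n. if n < N then 0 else \<beta> ^ n * cost_bound"
    have "(\<lambda>n. \<beta> ^ n * (\<beta> ^ N * cost_bound)) sums (1 / (1 - \<beta>) * (\<beta> ^ N * cost_bound))"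
      using \<beta>_pos \<beta>_less_1 by (intro sums_mult2 geometric_sums) simp
    then have "(\<lambda>n. ?e (n + N)) sums (\<beta> ^ N * cost_bound / (1 - \<beta>))"
      by (simp add: power_add mult.assoc)
    then show "?e sums (\<beta> ^ N * cost_bound / (1 - \<beta>))"
      by (subst (asm) sums_zero_iff_shift) auto
    fix n
    show "\<beta> ^ n * stage_cost M c \<pi>' n \<le> \<beta> ^ n * stage_cost M c \<pi> n + ?e n"
    proof (cases "n < N")
      case True
      then have "pair_dist M \<pi>' n = pair_dist M \<pi> n"
        by (simp add: pair_dist_def dist) (simp add: \<pi>'_def)
      then show ?thesis using True by (simp add: stage_cost_def)
    next
      case False
      have "\<beta> ^ n * stage_cost M c \<pi>' n \<le> \<beta> ^ n * cost_bound"
        using stage_cost_le[OF pol_M] \<beta>_pos by (intro mult_left_mono) auto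
      moreover have "0 \<le> \<beta> ^ n * stage_cost M c \<pi> n"
        using stage_cost_nonneg[OF pol] \<beta>_pos by simp
      ultimately show ?thesis using False by simp
    qed
  qed
  ultimately show ?thesis using that by blast
qed

text \<open>The switched policies compete in the infimum for every \<open>N\<close>, and their
  excess cost over \<open>\<pi>\<close> vanishes as \<open>N\<close> grows.\<close>

lemma INF_J_le_cleaned_up:
  assumes "\<pi> \<in> policies M'"
  shows "(INF \<pi>'\<in>max_reach_policies M B. J \<pi>') \<le> J \<pi>"
proof (rule LIMSEQ_le_const)
  have "(\<lambda>N. J \<pi> + \<beta> ^ N * cost_bound / (1 - \<beta>)) \<longlonglongrightarrow> J \<pi> + 0 * cost_bound / (1 - \<beta>)"
    using \<beta>_pos \<beta>_less_1 by (intro tendsto_intros LIMSEQ_power_zero) auto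
  then show "(\<lambda>N. J \<pi> + \<beta> ^ N * cost_bound / (1 - \<beta>)) \<longlonglongrightarrow> J \<pi>" by simp
  show "\<exists>N. \<forall>n\<ge>N. (INF \<pi>'\<in>max_reach_policies M B. J \<pi>') \<le> J \<pi> + \<beta> ^ n * cost_bound / (1 - \<beta>)"
  proof (intro exI allI impI)
    fix N
    obtain \<pi>' where "\<pi>' \<in> max_reach_policies M' B" "J \<pi>' \<le> J \<pi> + \<beta> ^ N * cost_bound / (1 - \<beta>)"
      using switch_to_optimal_choice[OF assms] .
    then show "(INF \<pi>'\<in>max_reach_policies M B. J \<pi>') \<le> J \<pi> + \<beta> ^ N * cost_bound / (1 - \<beta>)"
      by (intro cINF_lower2[OF bdd_below_J]) (auto simp: max_reach_policies_cleaned_up)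
  qed
qed

end

theorem theorem2:
  fixes M :: "('s, 'a) mdp" and B :: "'s set" and c :: "'s \<Rightarrow> 'a \<Rightarrow> real" and \<beta> :: real
  assumes mdp: "is_mdp M"
    and B_states: "B \<subseteq> states M"
    and B_absorbing: "\<forall>s\<in>B. absorbing M s"
    and cost_nonneg: "\<forall>s\<in>states M. \<forall>a\<in>actions M. 0 \<le> c s a"
    and discount: "0 < \<beta>" "\<beta> < 1"
  shows "(\<exists>\<pi>\<in>max_reach_policies M B.
            discounted_cost M c \<beta> \<pi> = (INF \<pi>'\<in>max_reach_policies M B. discounted_cost M c \<beta> \<pi>'))
     \<longleftrightarrow> (\<exists>\<pi>\<in>max_reach_policies (cleaned_up M B) B.
            is_arg_min (discounted_cost (cleaned_up M B) c \<beta>)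
              (\<lambda>\<pi>'. \<pi>' \<in> policies (cleaned_up M B)) \<pi>)"
proof -
  interpret discounted_target_mdp M B c \<beta>
    using assms by unfold_locales auto
  show ?thesis
    unfolding discounted_cost_cleaned_up
  proof
    \<comment> \<open>A constrained optimum costs no more than any policy of \<open>M'\<close>, and
      its cleaned version is a policy of \<open>M'\<close> with the same cost.\<close>
    assume "\<exists>\<pi>\<in>max_reach_policies M B. J \<pi> = (INF \<pi>'\<in>max_reach_policies M B. J \<pi>')"
    then obtain \<pi> where \<pi>: "\<pi> \<in> max_reach_policies M B" "J \<pi> = (INF \<pi>'\<in>max_reach_policies M B. J \<pi>')"
      by blast
    obtain \<pi>' where \<pi>': "\<pi>' \<in> max_reach_policies M' B" "J \<pi>' = J \<pi>"
      using optimal_policy_clean[OF \<pi>(1)] .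
    with \<pi>(2) INF_J_le_cleaned_up show "\<exists>\<pi>\<in>max_reach_policies M' B. is_arg_min J (\<lambda>\<pi>'. \<pi>' \<in> policies M') \<pi>"
      by (intro bexI[OF _ \<pi>'(1)]) (auto simp: is_arg_min_linorder max_reach_policies_cleaned_up)
  next
    \<comment> \<open>Each reachability-optimal competitor in \<open>M\<close> has a cleaned version
      of equal cost, to which minimality over \<open>policies M'\<close> applies.\<close>
    assume "\<exists>\<pi>\<in>max_reach_policies M' B. is_arg_min J (\<lambda>\<pi>'. \<pi>' \<in> policies M') \<pi>"
    then obtain \<pi> where \<pi>: "\<pi> \<in> max_reach_policies M B"
      and min: "\<And>\<pi>'. \<pi>' \<in> policies M' \<Longrightarrow> J \<pi> \<le> J \<pi>'"
      by (auto simp: is_arg_min_linorder max_reach_policies_cleaned_up)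
    have "J \<pi> \<le> J \<pi>'" if "\<pi>' \<in> max_reach_policies M B" for \<pi>'
      using optimal_policy_clean[OF that] min by (metis IntD2 max_reach_policies_cleaned_up)
    then have "(INF \<pi>'\<in>max_reach_policies M B. J \<pi>') = J \<pi>"
      using \<pi> by (intro cInf_eq_minimum) auto
    with \<pi> show "\<exists>\<pi>\<in>max_reach_policies M B. J \<pi> = (INF \<pi>'\<in>max_reach_policies M B. J \<pi>')"
      by (intro bexI[OF _ \<pi>]) simp
  qed
qed

end
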